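(* Let $n\ge 8$ be an integer and $G$ an arbitrary (not necessarily connected) graph of order $n$. Then $|M_G|\le q(n)$, where, writing $t$ for a positive integer, \[ q(n)=\begin{cases} 10^{t} & \text{if } n=5t;\\ 15\cdot 10^{t-1} & \text{if } n=5t+1;\\ 225\cdot 10^{t-2} & \text{if } n=5t+2;\\ 36\cdot 10^{t-1} & \text{if } n=5t+3;\\ 6\cdot 10^{t} & \text{if } n=5t+4, \end{cases} \] with equality if and only if \[ G=\begin{cases} tK_5 & \text{if } n=5t;\\ K_6\cup (t-1)K_5 & \text{if } n=5t+1;\\ 2K_6\cup (t-2)K_5 & \text{if } n=5t+2;\\ 2K_4\cup (t-1)K_5 & \text{if } n=5t+3;\\ K_4\cup tK_5 & \text{if } n=5t+4. \end{cases} \]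
   Context: Graphs are finite, simple, undirected. An induced matching is a matching whose endpoints induce a $1$-regular subgraph; it is maximal if not properly contained in another induced matching; $M_G$ is the set of maximal induced matchings of $G$. $K_r$ is the complete graph on $r$ vertices, $G\cup H$ is the disjoint union, $sH$ is the disjoint union of $s$ copies of $H$ (with $0H$ the empty graph). *)

theory Defs
  imports Main
begin

definition simple_graph :: "'a set \<Rightarrow> 'a set set \<Rightarrow> bool" where
  "simple_graph V E \<longleftrightarrow> finite V \<and> (\<forall>e\<in>E. e \<subseteq> V \<and> card e = 2)"

definition matching :: "'a set set \<Rightarrow> 'a set set \<Rightarrow> bool" where
  "matching E M \<longleftrightarrow> M \<subseteq> E \<and> (\<forall>e\<in>M. \<forall>e'\<in>M. e \<noteq> e' \<longrightarrow> e \<inter> e' = {})"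

definition induced_matching :: "'a set set \<Rightarrow> 'a set set \<Rightarrow> bool" where
  "induced_matching E M \<longleftrightarrow> matching E M \<and>
     (\<forall>v\<in>\<Union>M. card {u \<in> \<Union>M. {u, v} \<in> E} = 1)"

definition maximal_induced_matching :: "'a set set \<Rightarrow> 'a set set \<Rightarrow> bool" where
  "maximal_induced_matching E M \<longleftrightarrow> induced_matching E M \<and>
     \<not> (\<exists>M'. induced_matching E M' \<and> M \<subset> M')"

definition MIM :: "'a set set \<Rightarrow> 'a set set set" where
  "MIM E = {M. maximal_induced_matching E M}"

definition graph_iso :: "'a set \<Rightarrow> 'a set set \<Rightarrow> 'b set \<Rightarrow> 'b set set \<Rightarrow> bool" where
  "graph_iso V E W F \<longleftrightarrow> (\<exists>f. bij_betw f V W \<and>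
     (\<forall>x\<in>V. \<forall>y\<in>V. {x, y} \<in> E \<longleftrightarrow> {f x, f y} \<in> F))"

definition cliques_V :: "nat list \<Rightarrow> (nat \<times> nat) set" where
  "cliques_V ks = {(i, j). i < length ks \<and> j < ks ! i}"

definition cliques_E :: "nat list \<Rightarrow> (nat \<times> nat) set set" where
  "cliques_E ks = {{(i, j), (i, j')} | i j j'. i < length ks \<and> j < ks ! i \<and> j' < ks ! i \<and> j \<noteq> j'}"

definition q :: "nat \<Rightarrow> nat" where
  "q n = (let t = n div 5; r = n mod 5 in
     if r = 0 then 10 ^ t
     else if r = 1 then 15 * 10 ^ (t - 1)
     else if r = 2 then 225 * 10 ^ (t - 2)
     else if r = 3 then 36 * 10 ^ (t - 1)
     else 6 * 10 ^ t)"

text \<open>Clique sizes of the extremal graph of order n = 5t + r.\<close>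
definition extremal_list :: "nat \<Rightarrow> nat list" where
  "extremal_list n = (let t = n div 5; r = n mod 5 in
     if r = 0 then replicate t 5
     else if r = 1 then 6 # replicate (t - 1) 5
     else if r = 2 then [6, 6] @ replicate (t - 2) 5
     else if r = 3 then [4, 4] @ replicate (t - 1) 5
     else 4 # replicate t 5)"

end

theory Submission
  imports Defs "HOL-Library.Multiset"
begin

text \<open>
  Write \<open>m(G)\<close> for the number of maximal induced matchings. Distinguishing whether a vertex \<open>v\<close> is
  covered gives \<open>m(G) \<le> m(G - v) + (\<Sum>u\<in>N(v). m(G - N[u] - N[v]))\<close>, and \<open>m\<close> is multiplicative over
  disjoint unions. Induct on the order and let \<open>v\<close> have maximum degree \<open>d\<close>. If \<open>d \<ge> 6\<close>, the inequality
  is already strict. If no neighbour of \<open>v\<close> has a neighbour outside \<open>N[v]\<close>, then \<open>N[v]\<close> spans a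
  component on \<open>d + 1\<close> vertices, which is best if complete; this is the only source of equality.
  Otherwise some of the sets \<open>N[u] \<union> N[v]\<close> have more than \<open>d + 1\<close> elements, and the bound is again
  strict, after branching at a better vertex or once more in \<open>G - v\<close> in a few cases with \<open>d \<le> 4\<close>.
\<close>

subsection \<open>Maximal induced matchings\<close>

text \<open>A union of copies of K_k on n vertices has (k choose 2)^(n/k) maximal induced matchings,
  and (k choose 2)^(1/k) is largest at k = 5, with 6 and 4 next; so cliques of order 6 or 4 absorb
  the residue modulo 5. The bound w(n) grows by factors between 3/2 and 5/3 per vertex, depending on
  the residue, so each estimate has to be checked in all five classes. With maximum degree d and s
  neighbours of v that have a neighbour outside N[v], branching gives w(n-1) + (d-s) w(n-d-1) + s
  w(n-d-2). For s >= 1 this is below w(n) in every class unless (d, s) is (2, 1), (3, 1), (3, 2),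
  (4, 1) or (4, 2), where in some class it ties with w(n) or exceeds it. These five pairs dictate
  the special cases. The uniqueness of the extremal graphs is part of the induction hypothesis also
  because the ties at (4, 2) are broken by the structure of the extremal graphs of order n -
  1.\<close>

definition far :: "'a set set \<Rightarrow> 'a set \<Rightarrow> 'a set \<Rightarrow> bool" where
  "far E e f \<longleftrightarrow> (\<forall>g\<in>E. g \<inter> e = {} \<or> g \<inter> f = {})"

text \<open>\<open>MIM\<close> sees only the edge set, so deleting vertices means discarding the
  edges at them. The vertex set is tracked separately, since the bound depends on the order,
  isolated vertices included.\<close>

definition del :: "'a set set \<Rightarrow> 'a set \<Rightarrow> 'a set set" where
  "del E S = {e \<in> E. e \<inter> S = {}}"

definition nbrs :: "'a set set \<Rightarrow> 'a \<Rightarrow> 'a set" where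
  "nbrs E v = {u. {u, v} \<in> E}"

definition cnbrs :: "'a set set \<Rightarrow> 'a \<Rightarrow> 'a set" where
  "cnbrs E v = insert v (nbrs E v)"

definition all_edges :: "'a set \<Rightarrow> 'a set set" where
  "all_edges A = {e. e \<subseteq> A \<and> card e = 2}"

lemma card_2_other: "card e = 2 \<Longrightarrow> v \<in> e \<Longrightarrow> \<exists>u. e = {u, v} \<and> u \<noteq> v"
  unfolding card_2_iff by blast

lemma far_sym: "far E e f \<Longrightarrow> far E f e"
  by (auto simp: far_def)

text \<open>Taking \<open>g = e\<close> in \<open>far\<close> shows that far edges are disjoint; the
  other instances exclude a joining edge. Induced matchings are thus the independent sets of the
  square of the line graph, where two edges conflict if they are not far.\<close>

lemma induced_matching_iff:
  assumes E: "\<forall>e\<in>E. card e = 2"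
  shows "induced_matching E M \<longleftrightarrow> M \<subseteq> E \<and> pairwise (far E) M"
proof
  assume im: "induced_matching E M"
  then have ME: "M \<subseteq> E" and disj: "\<And>e f. e \<in> M \<Longrightarrow> f \<in> M \<Longrightarrow> e \<noteq> f \<Longrightarrow> e \<inter> f = {}"
    and one: "\<And>v. v \<in> \<Union>M \<Longrightarrow> card {u \<in> \<Union>M. {u, v} \<in> E} = 1"
    by (auto simp: induced_matching_def matching_def)
  have "far E e f" if ef: "e \<in> M" "f \<in> M" "e \<noteq> f" for e f
    unfolding far_def
  proof (rule ballI, rule ccontr)
    fix g assume g: "g \<in> E" "\<not> (g \<inter> e = {} \<or> g \<inter> f = {})"
    then obtain x y where xy: "x \<in> g" "x \<in> e" "y \<in> g" "y \<in> f" by auto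
    have "x \<noteq> y" using disj[OF ef] xy by auto
    then have gxy: "g = {y, x}" using E g(1) xy card_2_other by (metis insertE singletonD)
    obtain z where z: "e = {z, x}" "z \<noteq> x" using E ef(1) ME xy(2) card_2_other by (metis subsetD)
    obtain w where w: "{u \<in> \<Union>M. {u, x} \<in> E} = {w}"
      using one[of x] xy ef by (auto simp: card_1_singleton_iff)
    have "y \<in> {u \<in> \<Union>M. {u, x} \<in> E}" using xy ef g gxy by auto
    moreover have "z \<in> {u \<in> \<Union>M. {u, x} \<in> E}" using z ef ME by auto
    ultimately have "y = z" unfolding w by simp
    then show False using z xy disj[OF ef] by auto
  qed
  then show "M \<subseteq> E \<and> pairwise (far E) M" using ME by (auto simp: pairwise_def)
next
  assume "M \<subseteq> E \<and> pairwise (far E) M"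
  then have ME: "M \<subseteq> E" and far: "\<And>e f. e \<in> M \<Longrightarrow> f \<in> M \<Longrightarrow> e \<noteq> f \<Longrightarrow> far E e f"
    by (auto simp: pairwise_def)
  have disj: "e \<inter> f = {}" if ef: "e \<in> M" "f \<in> M" "e \<noteq> f" for e f
  proof -
    have "e \<in> E" using ef ME by auto
    then show ?thesis using far[OF ef] E by (fastforce simp: far_def)
  qed
  have "card {u \<in> \<Union>M. {u, v} \<in> E} = 1" if v: "v \<in> \<Union>M" for v
  proof -
    obtain e where e: "e \<in> M" "v \<in> e" using v by auto
    then obtain w where w: "e = {w, v}" "w \<noteq> v" using E ME card_2_other by (metis subsetD)
    have "u = w" if u: "u \<in> \<Union>M" "{u, v} \<in> E" for u
    proof -
      obtain f where f: "f \<in> M" "u \<in> f" using u by auto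
      have "{u, v} \<inter> f \<noteq> {}" "{u, v} \<inter> e \<noteq> {}" using f(2) e(2) by auto
      then have "\<not> far E f e" using u(2) by (auto simp only: far_def)
      then have "f = e" using far[OF f(1) e(1)] by blast
      moreover have "u \<noteq> v" using E u(2) by auto
      ultimately show ?thesis using f w by auto
    qed
    then have "{u \<in> \<Union>M. {u, v} \<in> E} = {w}" using e w ME by auto
    then show ?thesis by simp
  qed
  then show "induced_matching E M"
    using ME disj by (simp add: induced_matching_def matching_def)
qed

text \<open>An induced matching with a proper extension can be extended by a single edge, so
  maximality is a condition on one edge at a time.\<close>

lemma MIM_iff:
  assumes E: "\<forall>e\<in>E. card e = 2"
  shows "M \<in> MIM E \<longleftrightarrow> M \<subseteq> E \<and> pairwise (far E) M \<and> (\<forall>e\<in>E - M. \<exists>f\<in>M. \<not> far E e f)"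
proof -
  have key: "(\<exists>M'. M' \<subseteq> E \<and> pairwise (far E) M' \<and> M \<subset> M') \<longleftrightarrow> (\<exists>e\<in>E - M. \<forall>f\<in>M. far E e f)"
    if M: "M \<subseteq> E" "pairwise (far E) M"
  proof
    assume "\<exists>M'. M' \<subseteq> E \<and> pairwise (far E) M' \<and> M \<subset> M'"
    then obtain M' e where M': "M' \<subseteq> E" "pairwise (far E) M'" "M \<subset> M'" "e \<in> M' - M" by blast
    then have "e \<in> E - M" by blast
    moreover have "far E e f" if "f \<in> M" for f
    proof (rule pairwiseD[OF M'(2)])
      show "e \<in> M'" "f \<in> M'" "e \<noteq> f" using M' that by auto
    qed
    ultimately show "\<exists>e\<in>E - M. \<forall>f\<in>M. far E e f" by blast
  next
    assume "\<exists>e\<in>E - M. \<forall>f\<in>M. far E e f"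
    then obtain e where e: "e \<in> E - M" "\<forall>f\<in>M. far E e f" by blast
    then have "pairwise (far E) (insert e M)"
      using M(2) by (simp add: pairwise_insert far_sym)
    then show "\<exists>M'. M' \<subseteq> E \<and> pairwise (far E) M' \<and> M \<subset> M'"
      using e M by (intro exI[of _ "insert e M"]) auto
  qed
  have "M \<in> MIM E \<longleftrightarrow> (M \<subseteq> E \<and> pairwise (far E) M) \<and>
      \<not> (\<exists>M'. M' \<subseteq> E \<and> pairwise (far E) M' \<and> M \<subset> M')"
    by (simp add: MIM_def maximal_induced_matching_def induced_matching_iff[OF E] conj_assoc)
  also have "\<dots> \<longleftrightarrow> (M \<subseteq> E \<and> pairwise (far E) M) \<and> \<not> (\<exists>e\<in>E - M. \<forall>f\<in>M. far E e f)"
    using key by (intro conj_cong refl) simp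
  finally show ?thesis by simp
qed

lemma finite_MIM: "finite E \<Longrightarrow> finite (MIM E)"
  by (rule finite_subset[of _ "Pow E"])
    (auto simp: MIM_def maximal_induced_matching_def induced_matching_def matching_def)

lemma MIM_empty: "MIM {} = {{}}"
  by (auto simp: MIM_iff)

text \<open>If all edges conflict, an independent set has at most one edge and every singleton is
  maximal. This counts complete graphs and graphs on at most three vertices.\<close>

lemma MIM_pairwise_near:
  assumes E: "\<forall>e\<in>E. card e = 2" and "E \<noteq> {}"
    and near: "\<And>e f. e \<in> E \<Longrightarrow> f \<in> E \<Longrightarrow> \<not> far E e f"
  shows "card (MIM E) = card E"
proof -
  have "MIM E = (\<lambda>e. {e}) ` E"
  proof (rule set_eqI)
    fix M
    show "M \<in> MIM E \<longleftrightarrow> M \<in> (\<lambda>e. {e}) ` E"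
    proof
      assume "M \<in> MIM E"
      then have M: "M \<subseteq> E" "pairwise (far E) M" "\<forall>e\<in>E - M. \<exists>f\<in>M. \<not> far E e f"
        by (auto simp: MIM_iff[OF E])
      have "M \<noteq> {}" using M \<open>E \<noteq> {}\<close> by auto
      then obtain e where e: "e \<in> M" by auto
      have "M = {e}" using M(1,2) near e unfolding pairwise_def by blast
      then show "M \<in> (\<lambda>e. {e}) ` E" using M e by auto
    next
      assume "M \<in> (\<lambda>e. {e}) ` E"
      then show "M \<in> MIM E" using near by (auto simp: MIM_iff[OF E])
    qed
  qed
  then show ?thesis by (simp add: card_image)
qed

text \<open>Conflicts survive deletion: if \<open>e\<close> and \<open>f\<close> share a vertex,
  \<open>e\<close> itself is a witness; otherwise an edge meeting both has one end in each and so
  avoids \<open>S\<close>.\<close>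

lemma far_del:
  assumes E: "\<forall>e\<in>E. card e = 2" and "e \<in> del E S" "f \<in> del E S"
  shows "far (del E S) e f \<longleftrightarrow> far E e f"
proof -
  have "far E e f" if far: "far (del E S) e f"
    unfolding far_def
  proof (rule ballI, rule ccontr)
    fix g assume g: "g \<in> E" "\<not> (g \<inter> e = {} \<or> g \<inter> f = {})"
    then obtain x y where xy: "x \<in> g" "x \<in> e" "y \<in> g" "y \<in> f" by auto
    have "e \<inter> f = {}" using far assms E by (fastforce simp: far_def)
    then have "x \<noteq> y" using xy by auto
    then have "g = {y, x}" using E g(1) xy card_2_other by (metis insertE singletonD)
    then have "g \<in> del E S" using assms xy g by (auto simp: del_def)
    then show False using far g by (auto simp: far_def)
  qed
  moreover have "far E e f \<Longrightarrow> far (del E S) e f" by (auto simp: far_def del_def)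
  ultimately show ?thesis by blast
qed

lemma del_del: "del (del E S) T = del E (S \<union> T)"
  by (auto simp: del_def)

lemma del_empty: "del E {} = E"
  by (auto simp: del_def)

lemma del_subset: "del E S \<subseteq> E"
  by (auto simp: del_def)

lemma MIM_uncovered:
  assumes E: "\<forall>e\<in>E. card e = 2" and M: "M \<in> MIM E" and v: "v \<notin> \<Union>M"
  shows "M \<in> MIM (del E {v})"
proof -
  have D: "\<forall>e\<in>del E {v}. card e = 2" using E del_subset by fast
  have M': "M \<subseteq> E" "pairwise (far E) M" "\<forall>e\<in>E - M. \<exists>f\<in>M. \<not> far E e f"
    using M by (auto simp: MIM_iff[OF E])
  then have sub: "M \<subseteq> del E {v}" using v by (auto simp: del_def)
  have far: "\<And>e f. e \<in> del E {v} \<Longrightarrow> f \<in> M \<Longrightarrow> far (del E {v}) e f = far E e f"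
    using far_del[OF E] sub by blast
  have "pairwise (far (del E {v})) M" using M'(2) sub far unfolding pairwise_def by blast
  moreover have "\<forall>e\<in>del E {v} - M. \<exists>f\<in>M. \<not> far (del E {v}) e f"
    using M'(3) far del_subset by fast
  ultimately show ?thesis using sub by (simp add: MIM_iff[OF D])
qed

lemma MIM_edge:
  assumes E: "\<forall>e\<in>E. card e = 2" and M: "M \<in> MIM E" and e: "e \<in> M"
    and S: "S = \<Union>{g \<in> E. g \<inter> e \<noteq> {}}"
  shows "M - {e} \<in> MIM (del E S)"
proof -
  have D: "\<forall>e\<in>del E S. card e = 2" using E del_subset by fast
  have M': "M \<subseteq> E" "pairwise (far E) M" "\<forall>e\<in>E - M. \<exists>f\<in>M. \<not> far E e f"
    using M by (auto simp: MIM_iff[OF E])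
  \<comment> \<open>\<open>S\<close> is the union of the edges meeting \<open>e\<close>, so the
    edges missing \<open>S\<close> are exactly those that can accompany \<open>e\<close> in an
    induced matching.\<close>
  have farS: "f \<in> E \<Longrightarrow> f \<in> del E S \<longleftrightarrow> far E e f" for f
    unfolding S del_def far_def by auto
  have sub: "M - {e} \<subseteq> del E S" using M'(1,2) e farS unfolding pairwise_def by blast
  have far: "\<And>e' f. e' \<in> del E S \<Longrightarrow> f \<in> M - {e} \<Longrightarrow> far (del E S) e' f = far E e' f"
    using far_del[OF E] sub by blast
  have "pairwise (far (del E S)) (M - {e})"
    using M'(2) sub far unfolding pairwise_def by blast
  moreover have "\<exists>f\<in>M - {e}. \<not> far (del E S) e' f" if e': "e' \<in> del E S - (M - {e})" for e'
  proof -
    have "e' \<noteq> e" 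
    proof
      assume "e' = e"
      then have "e \<inter> S = {}" using e' by (auto simp: del_def)
      moreover have "e \<noteq> {}" "e \<subseteq> S" using e M'(1) E unfolding S by fastforce+
      ultimately show False by blast
    qed
    then have "e' \<in> E - M" using e' del_subset by fast
    then obtain f where f: "f \<in> M" "\<not> far E e' f" using M'(3) by blast
    have "far E e e'" using e' farS \<open>e' \<in> E - M\<close> by auto
    then have "f \<noteq> e" using f far_sym by blast
    then show ?thesis using f far e' by blast
  qed
  ultimately show ?thesis using sub by (simp add: MIM_iff[OF D])
qed

lemma Union_incident:
  assumes E: "\<forall>e\<in>E. card e = 2" and "{u, v} \<in> E"
  shows "\<Union>{g \<in> E. g \<inter> {u, v} \<noteq> {}} = cnbrs E u \<union> cnbrs E v" (is "?L = ?R")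
proof
  show "?L \<subseteq> ?R"
  proof
    fix x assume "x \<in> ?L"
    then obtain g y where g: "g \<in> E" "x \<in> g" "y \<in> g" "y = u \<or> y = v" by auto
    then have "x = y \<or> g = {x, y}" using E card_2_other by (metis insertE singletonD)
    then show "x \<in> ?R" using g by (auto simp: cnbrs_def nbrs_def)
  qed
  show "?R \<subseteq> ?L"
    using assms(2) by (fastforce simp: cnbrs_def nbrs_def)
qed

lemma nbrs_sym: "u \<in> nbrs E v \<longleftrightarrow> v \<in> nbrs E u"
  by (simp add: nbrs_def insert_commute)

text \<open>Sort the matchings by the edge that covers \<open>v\<close>, if any. Only an inequality
  results, because a maximal induced matching of the graph without \<open>v\<close> may be
  extendable by an edge at \<open>v\<close>.\<close>

lemma card_MIM_branch:
  assumes E: "\<forall>e\<in>E. card e = 2" and fin: "finite E" and N: "finite (nbrs E v)"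
  shows "card (MIM E) \<le> card (MIM (del E {v}))
    + (\<Sum>u\<in>nbrs E v. card (MIM (del E (cnbrs E u \<union> cnbrs E v))))"
proof -
  let ?I = "\<lambda>u. insert {u, v} ` MIM (del E (cnbrs E u \<union> cnbrs E v))"
  have "MIM E \<subseteq> MIM (del E {v}) \<union> (\<Union>u\<in>nbrs E v. ?I u)"
  proof
    fix M assume M: "M \<in> MIM E"
    show "M \<in> MIM (del E {v}) \<union> (\<Union>u\<in>nbrs E v. ?I u)"
    proof (cases "v \<in> \<Union>M")
      case True
      then obtain e where e: "e \<in> M" "v \<in> e" by auto
      have "e \<in> E" using M e by (auto simp: MIM_iff[OF E])
      then obtain u where u: "e = {u, v}" using E e(2) card_2_other by metis
      have "M - {e} \<in> MIM (del E (cnbrs E u \<union> cnbrs E v))"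
        using MIM_edge[OF E M e(1) refl] Union_incident[OF E] \<open>e \<in> E\<close> u by simp
      moreover have "M = insert {u, v} (M - {e})" using e u by auto
      moreover have "u \<in> nbrs E v" using \<open>e \<in> E\<close> u by (simp add: nbrs_def)
      ultimately show ?thesis by blast
    qed (use MIM_uncovered[OF E M] in blast)
  qed
  moreover have fin': "finite (MIM (del E S))" for S
    using finite_MIM finite_subset[OF del_subset fin] by blast
  ultimately have "card (MIM E) \<le> card (MIM (del E {v}) \<union> (\<Union>u\<in>nbrs E v. ?I u))"
    using N by (intro card_mono) auto
  also have "\<dots> \<le> card (MIM (del E {v})) + card (\<Union>u\<in>nbrs E v. ?I u)"
    by (rule card_Un_le)
  also have "card (\<Union>u\<in>nbrs E v. ?I u) \<le> (\<Sum>u\<in>nbrs E v. card (?I u))"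
    by (rule card_UN_le[OF N])
  also have "\<dots> \<le> (\<Sum>u\<in>nbrs E v. card (MIM (del E (cnbrs E u \<union> cnbrs E v))))"
    by (intro sum_mono card_image_le fin')
  finally show ?thesis by simp
qed

text \<open>Edges from different parts never conflict, so independence and maximality can be checked
  in each part; intersecting with \<open>E1\<close> and \<open>E2\<close> inverts
  \<open>(M, N) \<mapsto> M \<union> N\<close>.\<close>

lemma MIM_disjoint_Un:
  assumes E: "\<forall>e\<in>E1 \<union> E2. card e = 2" and disj: "\<Union>E1 \<inter> \<Union>E2 = {}"
  shows "card (MIM (E1 \<union> E2)) = card (MIM E1) * card (MIM E2)"
proof -
  have E1: "\<forall>e\<in>E1. card e = 2" and E2: "\<forall>e\<in>E2. card e = 2" using E by auto
  have dd: "e \<inter> f = {}" "f \<inter> e = {}" if "e \<in> E1" "f \<in> E2" for e f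
    using disj that by blast+
  have E12: "E1 \<inter> E2 = {}"
  proof (rule equals0I)
    fix e assume "e \<in> E1 \<inter> E2"
    then have "e \<inter> e = {}" and "e \<in> E1" using dd by blast+
    then show False using E1 by fastforce
  qed
  have far12: "far (E1 \<union> E2) e f" if "e \<in> E1" "f \<in> E2" for e f
    unfolding far_def
  proof
    fix g assume "g \<in> E1 \<union> E2"
    then show "g \<inter> e = {} \<or> g \<inter> f = {}" using dd that by (elim UnE) simp_all
  qed
  have far21: "far (E1 \<union> E2) e f" if "e \<in> E2" "f \<in> E1" for e f
    using far_sym[OF far12[OF that(2,1)]] .
  have far11: "far (E1 \<union> E2) e f = far E1 e f" if "e \<in> E1" "f \<in> E1" for e f
    using that by (simp add: far_def ball_Un dd)
  have far22: "far (E1 \<union> E2) e f = far E2 e f" if "e \<in> E2" "f \<in> E2" for e f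
    using that by (simp add: far_def ball_Un dd)
  have iff: "M \<union> N \<in> MIM (E1 \<union> E2) \<longleftrightarrow> M \<in> MIM E1 \<and> N \<in> MIM E2" if MN: "M \<subseteq> E1" "N \<subseteq> E2" for M N
  proof -
    have "pairwise (far (E1 \<union> E2)) M \<longleftrightarrow> pairwise (far E1) M"
      using far11 MN(1) by (simp add: pairwise_def subset_iff)
    moreover have "pairwise (far (E1 \<union> E2)) N \<longleftrightarrow> pairwise (far E2) N"
      using far22 MN(2) by (simp add: pairwise_def subset_iff)
    moreover have "pairwise (far (E1 \<union> E2)) (M \<union> N) \<longleftrightarrow>
      pairwise (far (E1 \<union> E2)) M \<and> pairwise (far (E1 \<union> E2)) N"
    proof
      assume "pairwise (far (E1 \<union> E2)) (M \<union> N)"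
      then show "pairwise (far (E1 \<union> E2)) M \<and> pairwise (far (E1 \<union> E2)) N"
        by (meson pairwise_subset sup_ge1 sup_ge2)
    next
      assume a: "pairwise (far (E1 \<union> E2)) M \<and> pairwise (far (E1 \<union> E2)) N"
      show "pairwise (far (E1 \<union> E2)) (M \<union> N)"
      proof (rule pairwiseI)
        fix e f assume ef: "e \<in> M \<union> N" "f \<in> M \<union> N" "e \<noteq> f"
        then consider "e \<in> M" "f \<in> M" | "e \<in> N" "f \<in> N" | "e \<in> M" "f \<in> N" | "e \<in> N" "f \<in> M"
          by blast
        then show "far (E1 \<union> E2) e f"
        proof cases
          case 1
          then show ?thesis using a ef(3) pairwiseD by metis
        next
          case 2
          then show ?thesis using a ef(3) pairwiseD by metis
        next
          case 3
          then show ?thesis using far12 MN by (simp add: subset_iff)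
        next
          case 4
          then show ?thesis using far21 MN by (simp add: subset_iff)
        qed
      qed
    qed
    moreover have "(\<forall>e\<in>E1 \<union> E2 - (M \<union> N). \<exists>f\<in>M \<union> N. \<not> far (E1 \<union> E2) e f) \<longleftrightarrow>
      (\<forall>e\<in>E1 - M. \<exists>f\<in>M. \<not> far E1 e f) \<and> (\<forall>e\<in>E2 - N. \<exists>f\<in>N. \<not> far E2 e f)" (is "?L \<longleftrightarrow> ?R1 \<and> ?R2")
    proof (intro iffI conjI ballI)
      fix e assume L: ?L and e: "e \<in> E1 - M"
      then have "e \<in> E1 \<union> E2 - (M \<union> N)" using MN E12 by blast
      then obtain f where f: "f \<in> M \<union> N" "\<not> far (E1 \<union> E2) e f" using L by blast
      then have "f \<in> M" using far12 e MN by blast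
      then show "\<exists>f\<in>M. \<not> far E1 e f" using f far11 e MN by blast
    next
      fix e assume L: ?L and e: "e \<in> E2 - N"
      then have "e \<in> E1 \<union> E2 - (M \<union> N)" using MN E12 by blast
      then obtain f where f: "f \<in> M \<union> N" "\<not> far (E1 \<union> E2) e f" using L by blast
      then have "f \<in> N" using far21 e MN by blast
      then show "\<exists>f\<in>N. \<not> far E2 e f" using f far22 e MN by blast
    next
      fix e assume R: "?R1 \<and> ?R2" and e: "e \<in> E1 \<union> E2 - (M \<union> N)"
      then consider "e \<in> E1 - M" | "e \<in> E2 - N" by blast
      then show "\<exists>f\<in>M \<union> N. \<not> far (E1 \<union> E2) e f"
      proof cases
        case 1
        then obtain f where "f \<in> M" "\<not> far E1 e f" using R by blast
        then have "\<not> far (E1 \<union> E2) e f" using far11 1 MN by blast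
        then show ?thesis using \<open>f \<in> M\<close> by blast
      next
        case 2
        then obtain f where "f \<in> N" "\<not> far E2 e f" using R by blast
        then have "\<not> far (E1 \<union> E2) e f" using far22 2 MN by blast
        then show ?thesis using \<open>f \<in> N\<close> by blast
      qed
    qed
    moreover have "M \<union> N \<subseteq> E1 \<union> E2" using MN by blast
    ultimately show ?thesis
      using MN by (simp only: MIM_iff[OF E] MIM_iff[OF E1] MIM_iff[OF E2]) blast
  qed
  have sub1: "M \<in> MIM E1 \<Longrightarrow> M \<subseteq> E1" for M by (simp add: MIM_iff[OF E1])
  have sub2: "M \<in> MIM E2 \<Longrightarrow> M \<subseteq> E2" for M by (simp add: MIM_iff[OF E2])
  have dec: "M \<inter> E1 \<union> M \<inter> E2 = M" if "M \<in> MIM (E1 \<union> E2)" for M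
  proof -
    have "M \<subseteq> E1 \<union> E2" using that by (simp add: MIM_iff[OF E])
    then show ?thesis by blast
  qed
  have "bij_betw (\<lambda>p. fst p \<union> snd p) (MIM E1 \<times> MIM E2) (MIM (E1 \<union> E2))"
  proof (rule bij_betw_byWitness[where f' = "\<lambda>M. (M \<inter> E1, M \<inter> E2)"])
    have "(M \<union> N) \<inter> E1 = M \<and> (M \<union> N) \<inter> E2 = N" if "M \<in> MIM E1" "N \<in> MIM E2" for M N
      using sub1[OF that(1)] sub2[OF that(2)] E12 by blast
    then show "\<forall>p\<in>MIM E1 \<times> MIM E2. ((fst p \<union> snd p) \<inter> E1, (fst p \<union> snd p) \<inter> E2) = p"
      by (simp add: mem_Times_iff prod_eq_iff)
    show "\<forall>M\<in>MIM (E1 \<union> E2). fst (M \<inter> E1, M \<inter> E2) \<union> snd (M \<inter> E1, M \<inter> E2) = M"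
      using dec by simp
    show "(\<lambda>p. fst p \<union> snd p) ` (MIM E1 \<times> MIM E2) \<subseteq> MIM (E1 \<union> E2)"
    proof (rule image_subsetI)
      fix p assume "p \<in> MIM E1 \<times> MIM E2"
      then have "fst p \<in> MIM E1" "snd p \<in> MIM E2" by (simp_all add: mem_Times_iff)
      then show "fst p \<union> snd p \<in> MIM (E1 \<union> E2)" using iff[OF sub1 sub2] by simp
    qed
    show "(\<lambda>M. (M \<inter> E1, M \<inter> E2)) ` MIM (E1 \<union> E2) \<subseteq> MIM E1 \<times> MIM E2"
    proof (rule image_subsetI)
      fix M assume M: "M \<in> MIM (E1 \<union> E2)"
      then have "M \<inter> E1 \<union> M \<inter> E2 \<in> MIM (E1 \<union> E2)" using dec[OF M] by simp
      then show "(M \<inter> E1, M \<inter> E2) \<in> MIM E1 \<times> MIM E2"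
        using iff[of "M \<inter> E1" "M \<inter> E2"] by simp
    qed
  qed
  then have "card (MIM E1 \<times> MIM E2) = card (MIM (E1 \<union> E2))" by (rule bij_betw_same_card)
  then show ?thesis by (simp add: card_cartesian_product)
qed

section \<open>Simple graphs and complete graphs\<close>

lemma simple_graphD:
  assumes "simple_graph V E"
  shows "finite V" "finite E" "\<forall>e\<in>E. card e = 2" "e \<in> E \<Longrightarrow> e \<subseteq> V"
proof -
  have "E \<subseteq> Pow V" "finite V" using assms by (auto simp: simple_graph_def)
  then show "finite E" by (meson finite_Pow_iff finite_subset)
qed (use assms in \<open>auto simp: simple_graph_def\<close>)

lemma pair_in_all_edges: "{x, y} \<in> all_edges A \<longleftrightarrow> x \<in> A \<and> y \<in> A \<and> x \<noteq> y"
  by (auto simp: all_edges_def card_insert_if)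

lemma card_MIM_all_edges:
  assumes "finite A" "card A \<ge> 2"
  shows "card (MIM (all_edges A)) = card A choose 2"
proof -
  have c: "card (all_edges A) = card A choose 2"
    unfolding all_edges_def by (rule n_subsets[OF assms(1)])
  have "card A choose 2 > 0" using assms(2) by (simp add: zero_less_binomial)
  then have ne: "all_edges A \<noteq> {}" using c by auto
  have "\<not> far (all_edges A) e f" if ef: "e \<in> all_edges A" "f \<in> all_edges A" for e f
  proof -
    obtain x y where xy: "x \<in> e" "y \<in> f" using ef by (fastforce simp: all_edges_def)
    have sub: "e \<subseteq> A" "f \<subseteq> A" using ef by (auto simp: all_edges_def)
    show ?thesis
    proof (cases "x = y")
      case True
      then have "e \<inter> e \<noteq> {}" "e \<inter> f \<noteq> {}" using xy by auto
      then show ?thesis using ef(1) by (auto simp only: far_def)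
    next
      case False
      then have "{x, y} \<in> all_edges A" using xy sub by (auto simp: pair_in_all_edges)
      moreover have "{x, y} \<inter> e \<noteq> {}" "{x, y} \<inter> f \<noteq> {}" using xy by auto
      ultimately show ?thesis by (auto simp only: far_def)
    qed
  qed
  then show ?thesis using MIM_pairwise_near[of "all_edges A"] ne c by (simp add: all_edges_def)
qed

subsection \<open>Disjoint unions of complete graphs\<close>

text \<open>The multiset records the clique orders. Orders are at least 2 so that the count is the
  product of the \<open>k choose 2\<close>: a single vertex would contribute the factor 1, but
  \<open>1 choose 2 = 0\<close>.\<close>

inductive clusters :: "'a set \<Rightarrow> 'a set set \<Rightarrow> nat multiset \<Rightarrow> bool" where
  empty: "clusters {} {} {#}"
| add: "clusters V E K \<Longrightarrow> finite A \<Longrightarrow> A \<inter> V = {} \<Longrightarrow> card A \<ge> 2 \<Longrightarrow>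
    clusters (A \<union> V) (all_edges A \<union> E) (add_mset (card A) K)"

lemma clusters_simple_graph: "clusters V E K \<Longrightarrow> simple_graph V E"
  by (induction rule: clusters.induct) (auto simp: simple_graph_def all_edges_def)

lemma clusters_card: "clusters V E K \<Longrightarrow> card V = sum_mset K"
proof (induction rule: clusters.induct)
  case (add V E K A)
  then show ?case using simple_graphD(1)[OF clusters_simple_graph[OF add(1)]]
    by (simp add: card_Un_disjoint)
qed simp

lemma clusters_card_MIM: "clusters V E K \<Longrightarrow> card (MIM E) = (\<Prod>k\<in>#K. k choose 2)"
proof (induction rule: clusters.induct)
  case (add V E K A)
  have V: "simple_graph V E" by (rule clusters_simple_graph[OF add(1)])
  have "\<forall>e\<in>all_edges A \<union> E. card e = 2"
    using simple_graphD(3)[OF V] by (auto simp: all_edges_def)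
  moreover have "\<Union>(all_edges A) \<inter> \<Union>E = {}"
    using simple_graphD(4)[OF V] add(3) by (fastforce simp: all_edges_def)
  ultimately show ?case
    using add by (simp add: MIM_disjoint_Un card_MIM_all_edges)
qed (simp add: MIM_empty)

lemma clusters_split:
  \<comment> \<open>Inversion at a prescribed clique: cliques can be permuted, so any of them may be
    taken as the one added last.\<close>
  "clusters V E K \<Longrightarrow> k \<in># K \<Longrightarrow> \<exists>A V' E'. finite A \<and> A \<inter> V' = {} \<and> card A = k \<and> k \<ge> 2 \<and>
    V = A \<union> V' \<and> E = all_edges A \<union> E' \<and> clusters V' E' (K - {#k#})"
proof (induction rule: clusters.induct)
  case (add V E K A)
  show ?case
  proof (cases "k = card A")
    case True
    then show ?thesis using add by (intro exI[of _ A] exI[of _ V] exI[of _ E]) simp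
  next
    case False
    then have "k \<in># K" using add by simp
    then obtain B V' E' where B: "finite B" "B \<inter> V' = {}" "card B = k" "k \<ge> 2"
      "V = B \<union> V'" "E = all_edges B \<union> E'" "clusters V' E' (K - {#k#})"
      using add.IH by blast
    have "clusters (A \<union> V') (all_edges A \<union> E') (add_mset (card A) (K - {#k#}))"
      using add B by (intro clusters.add) auto
    moreover have "add_mset (card A) (K - {#k#}) = add_mset (card A) K - {#k#}"
      using False by simp
    ultimately have "clusters (A \<union> V') (all_edges A \<union> E') (add_mset (card A) K - {#k#})" by simp
    moreover have "B \<inter> (A \<union> V') = {}" "A \<union> V = B \<union> (A \<union> V')"
      "all_edges A \<union> E = all_edges B \<union> (all_edges A \<union> E')" using B add by auto
    ultimately show ?thesis using B(1,3,4) by blast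
  qed
qed simp

section \<open>Isomorphism with the standard disjoint union of cliques\<close>

lemma cliques_V_snoc: "cliques_V (ks @ [k]) = {length ks} \<times> {..<k} \<union> cliques_V ks"
  by (auto simp: cliques_V_def nth_append less_Suc_eq split: if_splits)

lemma cliques_E_snoc: "cliques_E (ks @ [k]) = all_edges ({length ks} \<times> {..<k}) \<union> cliques_E ks"
  (is "?L = ?R")
proof
  show "?L \<subseteq> ?R"
  proof
    fix e assume "e \<in> ?L"
    then obtain i j j' where ij: "e = {(i, j), (i, j')}" "i < length (ks @ [k])" "j < (ks @ [k]) ! i"
      "j' < (ks @ [k]) ! i" "j \<noteq> j'" unfolding cliques_E_def by blast
    show "e \<in> ?R"
    proof (cases "i = length ks")
      case True
      then show ?thesis using ij by (simp add: pair_in_all_edges)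
    next
      case False
      then have "i < length ks" "j < ks ! i" "j' < ks ! i" using ij by (auto simp: nth_append)
      then show ?thesis using ij unfolding cliques_E_def by blast
    qed
  qed
  show "?R \<subseteq> ?L"
  proof
    fix e assume "e \<in> ?R"
    then consider "e \<in> all_edges ({length ks} \<times> {..<k})" | "e \<in> cliques_E ks" by blast
    then show "e \<in> ?L"
    proof cases
      case 1
      then obtain x y where "e = {x, y}" by (auto simp: all_edges_def card_2_iff)
      then obtain j j' where "e = {(length ks, j), (length ks, j')}" "j < k" "j' < k" "j \<noteq> j'"
        using 1 by (auto simp: pair_in_all_edges)
      then show ?thesis unfolding cliques_E_def mem_Collect_eq
        by (intro exI[of _ "length ks"] exI[of _ j] exI[of _ j']) simp
    next
      case 2
      then obtain i j j' where "e = {(i, j), (i, j')}" "i < length ks" "j < ks ! i"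
        "j' < ks ! i" "j \<noteq> j'" unfolding cliques_E_def by blast
      then show ?thesis unfolding cliques_E_def mem_Collect_eq
        by (intro exI[of _ i] exI[of _ j] exI[of _ j']) (simp add: nth_append)
    qed
  qed
qed

lemma clusters_cliques:
  "\<forall>k\<in>set ks. k \<ge> 2 \<Longrightarrow> clusters (cliques_V ks) (cliques_E ks) (mset ks)"
proof (induction ks rule: rev_induct)
  case Nil
  then show ?case using clusters.empty by (simp add: cliques_V_def cliques_E_def)
next
  case (snoc k ks)
  let ?A = "{length ks} \<times> {..<k}"
  have "clusters (?A \<union> cliques_V ks) (all_edges ?A \<union> cliques_E ks) (add_mset (card ?A) (mset ks))"
    using snoc by (intro clusters.add) (auto simp: cliques_V_def)
  then show ?case by (simp add: cliques_V_snoc cliques_E_snoc)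
qed

text \<open>Bijections of single cliques are glued together. The induction appends at the end of the
  list because the new clique then gets the index \<open>length ks\<close> and the older ones keep
  theirs.\<close>

lemma clusters_graph_iso:
  "clusters V E (mset ks) \<Longrightarrow> graph_iso V E (cliques_V ks) (cliques_E ks)"
proof (induction ks arbitrary: V E rule: rev_induct)
  case Nil
  then have "V = {}" by (auto elim: clusters.cases)
  then show ?case by (simp add: graph_iso_def cliques_V_def bij_betw_def)
next
  case (snoc k ks)
  obtain A V' E' where A: "finite A" "A \<inter> V' = {}" "card A = k" "k \<ge> 2"
    "V = A \<union> V'" "E = all_edges A \<union> E'" and V': "clusters V' E' (mset ks)"
    using clusters_split[OF snoc.prems, of k] by auto
  obtain f where f: "bij_betw f V' (cliques_V ks)"
    "\<And>x y. x \<in> V' \<Longrightarrow> y \<in> V' \<Longrightarrow> {x, y} \<in> E' \<longleftrightarrow> {f x, f y} \<in> cliques_E ks"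
    using snoc.IH[OF V'] unfolding graph_iso_def by blast
  let ?B = "{length ks} \<times> {..<k}"
  have "card A = card ?B" "finite ?B" using A by simp_all
  then obtain h where h: "bij_betw h A ?B"
    using A(1) finite_same_card_bij by blast
  define F where "F x = (if x \<in> A then h x else f x)" for x
  have FA: "F x = h x" "h x \<in> ?B" if "x \<in> A" for x
    using that h by (auto simp: F_def dest: bij_betw_apply)
  have FV: "F x = f x" "f x \<in> cliques_V ks" if "x \<in> V'" for x
    using that f(1) A(2) by (auto simp: F_def dest: bij_betw_apply)
  have disj: "?B \<inter> cliques_V ks = {}" by (auto simp: cliques_V_def)
  have "bij_betw F A ?B" using h FA(1) by (simp cong: bij_betw_cong)
  moreover have "bij_betw F V' (cliques_V ks)" using f(1) FV(1) by (simp cong: bij_betw_cong)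
  ultimately have "bij_betw F V (cliques_V (ks @ [k]))"
    unfolding A(5) cliques_V_snoc using disj by (rule bij_betw_combine)
  moreover have "{x, y} \<in> E \<longleftrightarrow> {F x, F y} \<in> cliques_E (ks @ [k])" if xy: "x \<in> V" "y \<in> V" for x y
  proof -
    have E'V: "x \<in> V' \<and> y \<in> V'" if "{x, y} \<in> E'" for x y
      using simple_graphD(4)[OF clusters_simple_graph[OF V'] that] by simp
    have cV: "a \<in> cliques_V ks \<and> b \<in> cliques_V ks" if "{a, b} \<in> cliques_E ks" for a b
      using that by (auto simp: cliques_E_def cliques_V_def doubleton_eq_iff)
    have inj: "h x = h y \<longleftrightarrow> x = y" if "x \<in> A" "y \<in> A"
      using h that by (auto simp: bij_betw_def inj_on_def)
    have notA: "x \<in> V' \<Longrightarrow> x \<notin> A" for x using A(2) by auto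
    have notB: "a \<in> cliques_V ks \<Longrightarrow> a \<notin> ?B" for a using disj by auto
    consider "x \<in> A" "y \<in> A" | "x \<in> A" "y \<in> V'" | "x \<in> V'" "y \<in> A" | "x \<in> V'" "y \<in> V'"
      using xy A(5) by blast
    then show ?thesis
    proof cases
      case 1
      then have "{x, y} \<in> E \<longleftrightarrow> x \<noteq> y"
        unfolding A(6) using E'V[of x y] notA by (metis UnCI UnE pair_in_all_edges)
      moreover have "{F x, F y} \<in> cliques_E (ks @ [k]) \<longleftrightarrow> h x \<noteq> h y"
        unfolding cliques_E_snoc using 1 FA cV[of "F x" "F y"] notB by (metis UnCI UnE pair_in_all_edges)
      ultimately show ?thesis using inj 1 by simp
    next
      case 2
      then have "{x, y} \<notin> E" unfolding A(6) using E'V notA by (auto simp: pair_in_all_edges)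
      moreover have "{F x, F y} \<notin> cliques_E (ks @ [k])"
        unfolding cliques_E_snoc using 2 FA FV cV notB by (metis UnE pair_in_all_edges)
      ultimately show ?thesis by simp
    next
      case 3
      then have "{x, y} \<notin> E" unfolding A(6) using E'V notA by (auto simp: pair_in_all_edges)
      moreover have "{F x, F y} \<notin> cliques_E (ks @ [k])"
        unfolding cliques_E_snoc using 3 FA FV cV notB by (metis UnE pair_in_all_edges)
      ultimately show ?thesis by simp
    next
      case 4
      then have "{x, y} \<in> E \<longleftrightarrow> {x, y} \<in> E'"
        unfolding A(6) using notA by (auto simp: pair_in_all_edges)
      moreover have "{F x, F y} \<in> cliques_E (ks @ [k]) \<longleftrightarrow> {f x, f y} \<in> cliques_E ks"
        unfolding cliques_E_snoc using 4 FV notB by (metis Un_iff pair_in_all_edges)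
      ultimately show ?thesis using f(2) 4 by simp
    qed
  qed
  ultimately show ?case unfolding graph_iso_def by blast
qed

lemma image_all_edges:
  assumes "inj_on g A"
  shows "all_edges (g ` A) = (`) g ` all_edges A"
proof
  show "all_edges (g ` A) \<subseteq> (`) g ` all_edges A"
  proof
    fix e assume e: "e \<in> all_edges (g ` A)"
    then obtain B where B: "B \<subseteq> A" "e = g ` B" by (auto simp: all_edges_def subset_image_iff)
    then have "card B = 2" using e card_image[OF inj_on_subset[OF assms B(1)]]
      by (simp add: all_edges_def)
    then show "e \<in> (`) g ` all_edges A" using B by (auto simp: all_edges_def)
  qed
  show "(`) g ` all_edges A \<subseteq> all_edges (g ` A)"
    using card_image[OF inj_on_subset[OF assms]] by (auto simp: all_edges_def)
qed

lemma clusters_image: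
  "clusters W F K \<Longrightarrow> inj_on g W \<Longrightarrow> clusters (g ` W) ((`) g ` F) K"
proof (induction rule: clusters.induct)
  case (add V E K A)
  have inj: "inj_on g A" "inj_on g V" using add.prems by (auto simp: inj_on_Un)
  have "card (g ` A) = card A" using inj by (simp add: card_image)
  moreover have "g ` A \<inter> g ` V = {}"
    using inj_on_image_Int[OF add.prems, of A V] add(3) by simp
  ultimately have "clusters (g ` A \<union> g ` V) (all_edges (g ` A) \<union> (`) g ` E) (add_mset (card (g ` A)) K)"
    using add inj by (intro clusters.add) auto
  then show ?case
    using \<open>card (g ` A) = card A\<close> by (simp add: image_Un image_all_edges[OF inj(1)])
qed (use clusters.empty in simp)

text \<open>Serves the converse of the equality statement: the clique structure is transported back
  along the inverse bijection, and with it the count.\<close>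

lemma clusters_graph_iso_inv:
  assumes W: "clusters W F K" and iso: "graph_iso V E W F" and V: "simple_graph V E"
  shows "clusters V E K"
proof -
  obtain f where f: "bij_betw f V W"
    "\<And>x y. x \<in> V \<Longrightarrow> y \<in> V \<Longrightarrow> {x, y} \<in> E \<longleftrightarrow> {f x, f y} \<in> F"
    using iso unfolding graph_iso_def by blast
  define g where "g = inv_into V f"
  have gf: "g (f x) = x" if "x \<in> V" for x
    using f(1) that by (auto simp: g_def bij_betw_def)
  have fg: "f (g y) = y" "g y \<in> V" if "y \<in> W" for y
    using f(1) that by (auto simp: g_def bij_betw_def f_inv_into_f inv_into_into)
  have bij: "bij_betw g W V" using bij_betw_inv_into[OF f(1)] by (simp add: g_def)
  have "E = (`) g ` F"
  proof
    show "E \<subseteq> (`) g ` F"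
    proof
      fix e assume e: "e \<in> E"
      then obtain x y where xy: "e = {x, y}" using simple_graphD(3)[OF V] by (auto simp: card_2_iff)
      then have "x \<in> V" "y \<in> V" using simple_graphD(4)[OF V e] by auto
      then have "{f x, f y} \<in> F" "e = g ` {f x, f y}" using f(2) e xy gf by auto
      then show "e \<in> (`) g ` F" by blast
    qed
    show "(`) g ` F \<subseteq> E"
    proof
      fix e assume "e \<in> (`) g ` F"
      then obtain d where d: "d \<in> F" "e = g ` d" by blast
      have sW: "simple_graph W F" by (rule clusters_simple_graph[OF W])
      then obtain a b where ab: "d = {a, b}" using simple_graphD(3)[OF sW] d by (auto simp: card_2_iff)
      then have "a \<in> W" "b \<in> W" using simple_graphD(4)[OF sW d(1)] by auto
      then have "{g a, g b} \<in> E" using f(2)[of "g a" "g b"] fg d ab by simp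
      then show "e \<in> E" using d ab by simp
    qed
  qed
  moreover have "V = g ` W" "inj_on g W" using bij by (auto simp: bij_betw_def)
  ultimately show ?thesis using clusters_image[OF W] by simp
qed

text \<open>A vertex is adjacent to the rest of its clique. Large cliques in the graph without
  \<open>v\<close> thus force large degrees, which will contradict the choice of
  \<open>v\<close>.\<close>

lemma clusters_degree:
  "clusters V E K \<Longrightarrow> \<forall>k\<in>#K. Suc d \<le> k \<Longrightarrow> u \<in> V \<Longrightarrow> d \<le> card (nbrs E u)"
proof (induction rule: clusters.induct)
  case (add V E K A)
  have s: "simple_graph (A \<union> V) (all_edges A \<union> E)"
    using clusters_simple_graph[OF clusters.add[OF add(1-4)]] .
  have "nbrs (all_edges A \<union> E) u \<subseteq> A \<union> V"
    using simple_graphD(4)[OF s] by (fastforce simp: nbrs_def)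
  then have fin: "finite (nbrs (all_edges A \<union> E) u)"
    using simple_graphD(1)[OF s] finite_subset by blast
  show ?case
  proof (cases "u \<in> A")
    case True
    then have "A - {u} \<subseteq> nbrs (all_edges A \<union> E) u"
      by (auto simp: nbrs_def pair_in_all_edges)
    then have "card (A - {u}) \<le> card (nbrs (all_edges A \<union> E) u)" using fin card_mono by blast
    moreover have "d \<le> card (A - {u})" using add.prems(1) add.hyps(2) True by auto
    ultimately show ?thesis by simp
  next
    case False
    then have "d \<le> card (nbrs E u)" using add by auto
    moreover have "nbrs E u \<subseteq> nbrs (all_edges A \<union> E) u" by (auto simp: nbrs_def)
    ultimately show ?thesis using card_mono[OF fin] le_trans by blast
  qed
qed simp

subsection \<open>The weight function\<close>

text \<open>Twenty times the bound \<open>q\<close>, continued to all orders by \<open>weight (n + 5) = 10 * weight n\<close>; the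
  factor 20 clears the fractions that occur for \<open>n < 8\<close>. There the continuation still bounds the
  number of maximal induced matchings, so the induction starts at the empty graph.\<close>

definition weight :: "nat \<Rightarrow> nat" where
  "weight n = [20, 30, 45, 72, 120] ! (n mod 5) * 10 ^ (n div 5)"

text \<open>The extremal clique sizes without reference to the order, so that the induction can add
  a single clique. Small members such as \<open>{#}\<close>, \<open>{#4#}\<close> and
  \<open>{#6#}\<close> belong to orders below 8.\<close>

definition optimal_sizes :: "nat multiset set" where
  "optimal_sizes = {K. \<exists>b. K = replicate_mset b 5 \<or> K = add_mset 6 (replicate_mset b 5) \<or>
    K = add_mset 6 (add_mset 6 (replicate_mset b 5)) \<or>
    K = add_mset 4 (add_mset 4 (replicate_mset b 5)) \<or> K = add_mset 4 (replicate_mset b 5)}"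

text \<open>With \<open>T = 10 ^ (n div 5)\<close> the eight weights become multiples of
  \<open>T\<close>, so every weight inequality turns into five numerical checks. The window reaches
  \<open>n + 7\<close>, as needed for maximum degree 5 with at least \<open>d + 2\<close> vertices,
  and for the reduction of larger degrees to 6.\<close>

lemma weight_cases:
  fixes n :: nat
  obtains T where "T > 0" "n mod 5 = 0" "weight n = 20 * T" "weight (n + 1) = 30 * T"
      "weight (n + 2) = 45 * T" "weight (n + 3) = 72 * T" "weight (n + 4) = 120 * T"
      "weight (n + 5) = 200 * T" "weight (n + 6) = 300 * T" "weight (n + 7) = 450 * T"
  | T where "T > 0" "n mod 5 = 1" "weight n = 30 * T" "weight (n + 1) = 45 * T"
      "weight (n + 2) = 72 * T" "weight (n + 3) = 120 * T" "weight (n + 4) = 200 * T"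
      "weight (n + 5) = 300 * T" "weight (n + 6) = 450 * T" "weight (n + 7) = 720 * T"
  | T where "T > 0" "n mod 5 = 2" "weight n = 45 * T" "weight (n + 1) = 72 * T"
      "weight (n + 2) = 120 * T" "weight (n + 3) = 200 * T" "weight (n + 4) = 300 * T"
      "weight (n + 5) = 450 * T" "weight (n + 6) = 720 * T" "weight (n + 7) = 1200 * T"
  | T where "T > 0" "n mod 5 = 3" "weight n = 72 * T" "weight (n + 1) = 120 * T"
      "weight (n + 2) = 200 * T" "weight (n + 3) = 300 * T" "weight (n + 4) = 450 * T"
      "weight (n + 5) = 720 * T" "weight (n + 6) = 1200 * T" "weight (n + 7) = 2000 * T"
  | T where "T > 0" "n mod 5 = 4" "weight n = 120 * T" "weight (n + 1) = 200 * T"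
      "weight (n + 2) = 300 * T" "weight (n + 3) = 450 * T" "weight (n + 4) = 720 * T"
      "weight (n + 5) = 1200 * T" "weight (n + 6) = 2000 * T" "weight (n + 7) = 3000 * T"
proof -
  define t where "t = n div 5"
  have w: "weight (5 * t + c) = [20, 30, 45, 72, 120] ! (c mod 5) * 10 ^ (t + c div 5)" for c
    by (simp add: weight_def)
  have "n = 5 * t + n mod 5" by (simp add: t_def)
  moreover have "n mod 5 = 0 \<or> n mod 5 = 1 \<or> n mod 5 = 2 \<or> n mod 5 = 3 \<or> n mod 5 = 4" by arith
  ultimately consider "n = 5 * t + 0" | "n = 5 * t + 1" | "n = 5 * t + 2" | "n = 5 * t + 3" | "n = 5 * t + 4"
    by metis
  then show thesis
  proof cases
    case 1
    show thesis by (rule that(1)[of "10 ^ t"]; (simp only: 1 add.assoc w)?; simp)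
  next
    case 2
    show thesis by (rule that(2)[of "10 ^ t"]; (simp only: 2 add.assoc w)?; (simp; fail | presburger))
  next
    case 3
    show thesis by (rule that(3)[of "10 ^ t"]; (simp only: 3 add.assoc w)?; (simp; fail | presburger))
  next
    case 4
    show thesis by (rule that(4)[of "10 ^ t"]; (simp only: 4 add.assoc w)?; (simp; fail | presburger))
  next
    case 5
    show thesis by (rule that(5)[of "10 ^ t"]; (simp only: 5 add.assoc w)?; (simp; fail | presburger))
  qed
qed

lemma weight_Suc: "3 * weight n \<le> 2 * weight (n + 1)"
  by (cases rule: weight_cases[of n]) simp_all

lemma weight_pos: "weight n > 0"
  by (cases rule: weight_cases[of n]) simp_all

lemma weight_strict_mono: "strict_mono weight"
proof (rule strict_mono_Suc_iff[THEN iffD2], rule allI)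
  fix n show "weight n < weight (Suc n)" using weight_Suc[of n] weight_pos[of n] by simp
qed

lemma weight_eq_q: "n \<ge> 8 \<Longrightarrow> weight n = 20 * q n"
proof -
  assume n: "n \<ge> 8"
  define t r where "t = n div 5" and "r = n mod 5"
  have nt: "n = 5 * t + r" "r < 5" by (auto simp: t_def r_def)
  have w: "weight n = [20, 30, 45, 72, 120] ! r * 10 ^ t" by (simp add: weight_def t_def r_def)
  have q: "q n = (if r = 0 then 10 ^ t
     else if r = 1 then 15 * 10 ^ (t - 1)
     else if r = 2 then 225 * 10 ^ (t - 2)
     else if r = 3 then 36 * 10 ^ (t - 1)
     else 6 * 10 ^ t)" by (simp add: q_def t_def r_def Let_def)
  obtain a where a: "t = Suc a" using n nt by (cases t) auto
  show ?thesis
  proof (cases "r = 2")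
    case True
    \<comment> \<open>Order at least 8 with residue 2 means order at least 12, so the exponent
      \<open>t - 2\<close> of \<open>q\<close> is not truncated.\<close>
    then obtain b where "a = Suc b" using n nt a by (cases a) auto
    then show ?thesis using w q True a by simp
  next
    case False
    then have "r = 0 \<or> r = 1 \<or> r = 3 \<or> r = 4" using nt by auto
    then show ?thesis using w q a by auto
  qed
qed

lemma optimal_sizes_cases:
  assumes "K \<in> optimal_sizes"
  obtains b where "K = replicate_mset b 5" "sum_mset K = 5 * b" "sum_mset K mod 5 = 0"
  | b where "K = add_mset 6 (replicate_mset b 5)" "sum_mset K = 5 * (b + 1) + 1" "sum_mset K mod 5 = 1"
  | b where "K = add_mset 6 (add_mset 6 (replicate_mset b 5))" "sum_mset K = 5 * (b + 2) + 2" "sum_mset K mod 5 = 2"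
  | b where "K = add_mset 4 (add_mset 4 (replicate_mset b 5))" "sum_mset K = 5 * (b + 1) + 3" "sum_mset K mod 5 = 3"
  | b where "K = add_mset 4 (replicate_mset b 5)" "sum_mset K = 5 * b + 4" "sum_mset K mod 5 = 4"
proof -
  have s: "sum_mset (replicate_mset b (5::nat)) = 5 * b" for b by (simp add: sum_mset_replicate_mset)
  obtain b where "K = replicate_mset b 5 \<or> K = add_mset 6 (replicate_mset b 5) \<or>
    K = add_mset 6 (add_mset 6 (replicate_mset b 5)) \<or>
    K = add_mset 4 (add_mset 4 (replicate_mset b 5)) \<or> K = add_mset 4 (replicate_mset b 5)"
    using assms unfolding optimal_sizes_def by blast
  then consider "K = replicate_mset b 5" "sum_mset K = 5 * b"
    | "K = add_mset 6 (replicate_mset b 5)" "sum_mset K = 5 * (b + 1) + 1"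
    | "K = add_mset 6 (add_mset 6 (replicate_mset b 5))" "sum_mset K = 5 * (b + 2) + 2"
    | "K = add_mset 4 (add_mset 4 (replicate_mset b 5))" "sum_mset K = 5 * (b + 1) + 3"
    | "K = add_mset 4 (replicate_mset b 5)" "sum_mset K = 5 * b + 4"
    by (elim disjE) (auto simp: s)
  then show thesis
  proof cases
    case 1
    then have "sum_mset K mod 5 = 0" by presburger
    with 1 show thesis by (rule that(1))
  next
    case 2
    then have "sum_mset K mod 5 = 1" by presburger
    with 2 show thesis by (rule that(2))
  next
    case 3
    then have "sum_mset K mod 5 = 2" by presburger
    with 3 show thesis by (rule that(3))
  next
    case 4
    then have "sum_mset K mod 5 = 3" by presburger
    with 4 show thesis by (rule that(4))
  next
    case 5
    then have "sum_mset K mod 5 = 4" by presburger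
    with 5 show thesis by (rule that(5))
  qed
qed

text \<open>The residue of the order selects the family and the quotient the number of
  fives.\<close>

lemma optimal_sizes_extremal_list:
  assumes K: "K \<in> optimal_sizes" and n: "sum_mset K = n"
  shows "K = mset (extremal_list n)"
  using K
proof (cases rule: optimal_sizes_cases)
  case (1 b)
  then have "n div 5 = b" "n mod 5 = 0" using n by presburger+
  then show ?thesis using 1(1) by (simp add: extremal_list_def)
next
  case (2 b)
  then have "n div 5 = b + 1" "n mod 5 = 1" using n by presburger+
  then show ?thesis using 2(1) by (simp add: extremal_list_def)
next
  case (3 b)
  then have "n div 5 = b + 2" "n mod 5 = 2" using n by presburger+
  then show ?thesis using 3(1) by (simp add: extremal_list_def)
next
  case (4 b)
  then have "n div 5 = b + 1" "n mod 5 = 3" using n by presburger+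
  then show ?thesis using 4(1) by (simp add: extremal_list_def)
next
  case (5 b)
  then have "n div 5 = b" "n mod 5 = 4" using n by presburger+
  then show ?thesis using 5(1) by (simp add: extremal_list_def)
qed

lemma extremal_list_ge_2: "k \<in> set (extremal_list n) \<Longrightarrow> k \<ge> 2"
  by (auto simp: extremal_list_def Let_def split: if_splits)

lemma prod_extremal_list: "(\<Prod>k\<in>#mset (extremal_list n). k choose 2) = q n"
proof -
  have c: "4 choose 2 = (6::nat)" "5 choose 2 = (10::nat)" "6 choose 2 = (15::nat)"
    by (simp_all add: choose_two)
  show ?thesis
    unfolding extremal_list_def q_def Let_def
    by (simp add: c image_replicate_mset del: binomial_eq_0_iff)
qed

section \<open>Graphs on at most three vertices, and enlarging the extremal sizes\<close>

lemma simple_graph_del: "simple_graph V E \<Longrightarrow> simple_graph (V - S) (del E S)"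
  by (auto simp: simple_graph_def del_def)

lemma simple_graph_subset_all_edges: "simple_graph V E \<Longrightarrow> E \<subseteq> all_edges V"
  by (auto simp: simple_graph_def all_edges_def)

lemma card_MIM_le_3:
  assumes G: "simple_graph V E" and V: "card V \<le> 3"
  shows "card (MIM E) = 1 \<or> card (MIM E) = card E"
proof (cases "E = {}")
  case False
  have "\<not> far E e f" if ef: "e \<in> E" "f \<in> E" for e f
  proof -
    have c: "card e = 2" "card f = 2" using simple_graphD(3)[OF G] ef by auto
    then have fin: "finite e" "finite f" by (auto intro: card_ge_0_finite)
    have "e \<union> f \<subseteq> V" using simple_graphD(4)[OF G] ef by blast
    then have "card (e \<union> f) \<le> 3" using card_mono[OF simple_graphD(1)[OF G]] V le_trans by blast
    then have "e \<inter> f \<noteq> {}" using card_Un_disjoint[OF fin] c by fastforce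
    moreover have "e \<inter> e \<noteq> {}" using c by auto
    ultimately show ?thesis using ef(1) by (auto simp only: far_def)
  qed
  then show ?thesis using MIM_pairwise_near[OF simple_graphD(3)[OF G] False] by blast
qed (simp add: MIM_empty)

text \<open>Order 3 is treated by hand: \<open>weight 3 = 72\<close> exceeds \<open>20 * 3\<close>,
  so the equality clause of the induction hypothesis cannot recognise the triangle.\<close>

lemma card_MIM_triangle:
  assumes G: "simple_graph V E" and V: "card V = 3"
  shows "card (MIM E) \<le> 3 \<and> (card (MIM E) = 3 \<longrightarrow> E = all_edges V)"
proof -
  have fin: "finite (all_edges V)" using simple_graphD(1)[OF G] by (simp add: all_edges_def)
  have c: "card (all_edges V) = 3"
    using n_subsets[OF simple_graphD(1)[OF G], of 2] V by (simp add: all_edges_def choose_two)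
  have sub: "E \<subseteq> all_edges V" by (rule simple_graph_subset_all_edges[OF G])
  have "card E \<le> 3" using card_mono[OF fin sub] c by simp
  moreover have "card E = 3 \<longrightarrow> E = all_edges V" using card_subset_eq[OF fin sub] c by simp
  ultimately show ?thesis using card_MIM_le_3[OF G] V by auto
qed

lemma clusters_empty: "clusters V E {#} \<Longrightarrow> V = {} \<and> E = {}"
  by (erule clusters.cases) auto

lemma clusters_single: "clusters V E {#k#} \<Longrightarrow> E = all_edges V"
proof -
  assume "clusters V E {#k#}"
  then obtain A V' E' where "V = A \<union> V'" "E = all_edges A \<union> E'" "clusters V' E' {#}"
    using clusters_split[of V E "{#k#}" k] by auto
  then show ?thesis using clusters_empty by fastforce
qed

lemma optimal_sizes_single:
  assumes K: "K \<in> optimal_sizes" and s: "sum_mset K = k" "k = 4 \<or> k = 5"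
  shows "K = {#k#}"
  using K
proof (cases rule: optimal_sizes_cases)
  case (1 b)
  then have "b = 1" "k = 5" using s by presburger+
  then show ?thesis using 1 by simp
next
  case (5 b)
  then have "b = 0" "k = 4" using s by presburger+
  then show ?thesis using 5 by simp
next
  case (2 b)
  then have False using s by presburger
  then show ?thesis ..
next
  case (3 b)
  then have False using s by presburger
  then show ?thesis ..
next
  case (4 b)
  then have False using s by presburger
  then show ?thesis ..
qed

lemma optimal_sizes_add_5:
  assumes "K \<in> optimal_sizes"
  shows "add_mset 5 K \<in> optimal_sizes"
proof -
  have r: "add_mset 5 (replicate_mset b 5) = replicate_mset (Suc b) (5::nat)" for b by simp
  have c: "add_mset 5 (add_mset x (replicate_mset b 5)) = add_mset x (replicate_mset (Suc b) (5::nat))"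
    "add_mset 5 (add_mset x (add_mset x (replicate_mset b 5))) =
      add_mset x (add_mset x (replicate_mset (Suc b) (5::nat)))" for b x
    by (simp_all add: add_mset_commute)
  show ?thesis
    using assms by (cases rule: optimal_sizes_cases) (simp_all only: r c, auto simp only: optimal_sizes_def)
qed

text \<open>The two residues are those of \<open>x\<close> with
  \<open>6 * weight x = weight (x + 4)\<close>. For a clique of order 6 the equation
  \<open>15 * weight x = weight (x + 6)\<close> singles out 0 and 1; for order 5 there is no
  restriction.\<close>

lemma optimal_sizes_add_4:
  assumes "K \<in> optimal_sizes" "sum_mset K mod 5 = 0 \<or> sum_mset K mod 5 = 4"
  shows "add_mset 4 K \<in> optimal_sizes"
  using assms(1)
proof (cases rule: optimal_sizes_cases)
  case (2 b)
  then show ?thesis using assms(2) 2(3) by simp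
next
  case (3 b)
  then show ?thesis using assms(2) 3(3) by simp
next
  case (4 b)
  then show ?thesis using assms(2) 4(3) by simp
qed (auto simp only: optimal_sizes_def)

lemma optimal_sizes_add_6:
  assumes "K \<in> optimal_sizes" "sum_mset K mod 5 = 0 \<or> sum_mset K mod 5 = 1"
  shows "add_mset 6 K \<in> optimal_sizes"
  using assms(1)
proof (cases rule: optimal_sizes_cases)
  case (3 b)
  then show ?thesis using assms(2) 3(3) by simp
next
  case (4 b)
  then show ?thesis using assms(2) 4(3) by simp
next
  case (5 b)
  then show ?thesis using assms(2) 5(3) by simp
qed (auto simp only: optimal_sizes_def)

lemma optimal_sizes_ge_5:
  assumes "K \<in> optimal_sizes" "sum_mset K mod 5 = 0 \<or> sum_mset K mod 5 = 1" "k \<in># K"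
  shows "5 \<le> k"
  using assms(1)
proof (cases rule: optimal_sizes_cases)
  case (4 b)
  then show ?thesis using assms(2) 4(3) by simp
next
  case (5 b)
  then show ?thesis using assms(2) 5(3) by simp
qed (use assms(3) in \<open>auto split: if_splits\<close>)

text \<open>Raising the degree by one adds a branch but removes one more vertex from each. The
  weight drops by a factor of at least 3/2, which outweighs (d + 1)/d, so degree 6 is the worst
  case.\<close>

lemma weight_mult_degree:
  assumes "d \<ge> 6"
  shows "d * weight x \<le> 6 * weight (x + (d - 6))"
  using assms
proof (induction d arbitrary: x rule: dec_induct)
  case (step d)
  have "2 * (Suc d * weight x) \<le> d * (3 * weight x)" using step(1) by (simp add: algebra_simps)
  also have "\<dots> \<le> d * (2 * weight (x + 1))" using weight_Suc[of x] mult_le_mono2 by blast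
  finally have "Suc d * weight x \<le> d * weight (x + 1)" by simp
  also have "\<dots> \<le> 6 * weight (x + 1 + (d - 6))" by (rule step.IH)
  also have "x + 1 + (d - 6) = x + (Suc d - 6)" using step(1) by simp
  finally show ?case .
qed simp

lemma weight_large_degree:
  assumes "d \<ge> 6" "n \<ge> d + 1"
  shows "weight (n - 1) + d * weight (n - (d + 1)) < weight n"
proof -
  have "n = (n - 7) + 7" using assms by simp
  then obtain y where y: "n = y + 7" by blast
  have "n - (d + 1) + (d - 6) = y" using assms y by simp
  then have "d * weight (n - (d + 1)) \<le> 6 * weight y" using weight_mult_degree[OF assms(1)] by metis
  moreover have "weight (y + 6) + 6 * weight y < weight (y + 7)"
    by (cases rule: weight_cases[of y]) simp_all
  moreover have "weight (n - 1) = weight (y + 6)" using y by (simp add: add.commute)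
  ultimately have "weight (n - 1) + d * weight (n - (d + 1)) < weight (y + 7)" by linarith
  then show ?thesis using y by simp
qed

subsection \<open>The induction step\<close>

text \<open>Every graph met while branching is obtained by deleting a nonempty vertex set, so the
  induction hypothesis is stated for deletions and shared by all case lemmas.\<close>

locale minimal_graph =
  fixes V :: "'a set" and E :: "'a set set"
  assumes graph: "simple_graph V E"
    and IH: "\<And>S. S \<subseteq> V \<Longrightarrow> S \<noteq> {} \<Longrightarrow> 20 * card (MIM (del E S)) \<le> weight (card (V - S))"
    and IH_eq: "\<And>S. S \<subseteq> V \<Longrightarrow> S \<noteq> {} \<Longrightarrow> 20 * card (MIM (del E S)) = weight (card (V - S)) \<Longrightarrow>
      \<exists>K\<in>optimal_sizes. clusters (V - S) (del E S) K"
begin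

abbreviation n :: nat where "n \<equiv> card V"
abbreviation m :: "'a set \<Rightarrow> nat" where "m S \<equiv> card (MIM (del E S))"
abbreviation N :: "'a \<Rightarrow> 'a set" where "N v \<equiv> nbrs E v"
abbreviation C :: "'a \<Rightarrow> 'a set" where "C v \<equiv> cnbrs E v"

text \<open>An edge to an outer neighbour removes more than the closed neighbourhood of \<open>v\<close>.\<close>

definition outer :: "'a \<Rightarrow> 'a set" where
  "outer v = {u \<in> N v. \<not> C u \<subseteq> C v}"

lemmas fin_V = simple_graphD(1)[OF graph] and fin_E = simple_graphD(2)[OF graph]
  and card_edge = simple_graphD(3)[OF graph] and edge_sub = simple_graphD(4)[OF graph]

lemma N_sub: "N v \<subseteq> V"
  using edge_sub by (auto simp: nbrs_def)

lemma N_in_V: "u \<in> N v \<Longrightarrow> v \<in> V"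
  using edge_sub by (auto simp: nbrs_def)

lemma fin_N: "finite (N v)"
  using finite_subset[OF N_sub fin_V] .

lemma not_in_N: "v \<notin> N v"
  using card_edge by (auto simp: nbrs_def)

lemma C_sub: "v \<in> V \<Longrightarrow> C v \<subseteq> V"
  using N_sub by (simp add: cnbrs_def)

lemma fin_C: "finite (C v)"
  using fin_N by (simp add: cnbrs_def)

lemma card_C: "card (C v) = card (N v) + 1"
  using fin_N not_in_N by (simp add: cnbrs_def)

lemma edge_through: "e \<in> E \<Longrightarrow> x \<in> e \<Longrightarrow> \<exists>y\<in>N x. e = {y, x}"
  using card_edge card_2_other[of e x] by (auto simp: nbrs_def)

lemma bound:
  assumes "S \<subseteq> V" "0 < k" "k \<le> card S"
  shows "20 * m S \<le> weight (n - k)"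
proof -
  have "S \<noteq> {}" using assms by auto
  then have "20 * m S \<le> weight (card (V - S))" using IH assms by blast
  also have "card (V - S) = n - card S" using assms(1) fin_V by (simp add: card_Diff_subset finite_subset)
  also have "weight (n - card S) \<le> weight (n - k)"
    using strict_mono_less_eq[OF weight_strict_mono] assms(3) by simp
  finally show ?thesis .
qed

text \<open>Branching inside the graph without \<open>S\<close>, but written with neighbourhoods of
  the whole graph; the difference lies in \<open>S\<close>, which is deleted anyway.\<close>

lemma branch:
  assumes "w \<notin> S"
  shows "m S \<le> m (insert w S) + (\<Sum>u\<in>N w - S. m (S \<union> C u \<union> C w))"
proof -
  have D: "\<forall>e\<in>del E S. card e = 2" using card_edge del_subset by fast
  have nb: "nbrs (del E S) u = N u - S" if "u \<notin> S" for u
    using that by (auto simp: nbrs_def del_def)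
  have cn: "S \<union> cnbrs (del E S) u = S \<union> C u" if "u \<notin> S" for u
    using nb[OF that] by (auto simp: cnbrs_def)
  have "card (MIM (del E S)) \<le> card (MIM (del (del E S) {w}))
    + (\<Sum>u\<in>nbrs (del E S) w. card (MIM (del (del E S) (cnbrs (del E S) u \<union> cnbrs (del E S) w))))"
    using fin_N nb[OF assms] by (intro card_MIM_branch D finite_subset[OF del_subset fin_E]) simp
  also have "(\<Sum>u\<in>nbrs (del E S) w. card (MIM (del (del E S) (cnbrs (del E S) u \<union> cnbrs (del E S) w))))
    = (\<Sum>u\<in>N w - S. m (S \<union> C u \<union> C w))"
    unfolding nb[OF assms]
  proof (rule sum.cong[OF refl])
    fix u assume "u \<in> N w - S"
    then have "S \<union> (cnbrs (del E S) u \<union> cnbrs (del E S) w) = S \<union> C u \<union> C w"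
      using cn[of u] cn[OF assms] by blast
    then show "card (MIM (del (del E S) (cnbrs (del E S) u \<union> cnbrs (del E S) w))) = m (S \<union> C u \<union> C w)"
      by (simp add: del_del)
  qed
  finally show ?thesis by (simp add: del_del)
qed

lemma branch0: "card (MIM E) \<le> m {w} + (\<Sum>u\<in>N w. m (C u \<union> C w))"
  using branch[of w "{}"] by (simp add: del_empty)

lemma outer_bound:
  assumes "u \<in> outer v"
  shows "card (C v) + 1 \<le> card (C u \<union> C v)"
proof -
  obtain x where x: "x \<in> C u" "x \<notin> C v" using assms by (auto simp: outer_def)
  have "card (insert x (C v)) \<le> card (C u \<union> C v)" using x fin_C by (intro card_mono) auto
  then show ?thesis using x fin_C by simp
qed

lemma outer_order:
  assumes "u \<in> outer v"
  shows "card (N v) + 2 \<le> n"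
proof -
  have "u \<in> V" "v \<in> V" using assms N_sub N_in_V by (auto simp: outer_def)
  then have "C u \<union> C v \<subseteq> V" using C_sub by simp
  then have "card (C u \<union> C v) \<le> n" by (rule card_mono[OF fin_V])
  then show ?thesis using outer_bound[OF assms] card_C[of v] by simp
qed

lemma sum_bound:
  assumes "\<And>u. u \<in> A \<Longrightarrow> 20 * f u \<le> (b::nat)"
  shows "20 * (\<Sum>u\<in>A. f u) \<le> card A * b"
  using sum_bounded_above[of A "\<lambda>u. 20 * f u" b] assms by (simp add: sum_distrib_left)

text \<open>The term \<open>m {v}\<close> is left unestimated because several cases improve on
  \<open>weight (n - 1)\<close>.\<close>

lemma direct:
  assumes v: "v \<in> V"
  shows "20 * card (MIM E) \<le> 20 * m {v} + (card (N v) - card (outer v)) * weight (n - (card (N v) + 1))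
    + card (outer v) * weight (n - (card (N v) + 2))"
proof -
  have sub: "outer v \<subseteq> N v" by (auto simp: outer_def)
  have CV: "C u \<union> C v \<subseteq> V" if "u \<in> N v" for u using that N_sub C_sub v by blast
  have a: "20 * (\<Sum>u\<in>N v - outer v. m (C u \<union> C v)) \<le> card (N v - outer v) * weight (n - (card (N v) + 1))"
  proof (rule sum_bound)
    fix u assume u: "u \<in> N v - outer v"
    have "card (C v) \<le> card (C u \<union> C v)" using fin_C by (intro card_mono) auto
    then show "20 * m (C u \<union> C v) \<le> weight (n - (card (N v) + 1))"
      using u by (intro bound CV) (auto simp: card_C)
  qed
  have b: "20 * (\<Sum>u\<in>outer v. m (C u \<union> C v)) \<le> card (outer v) * weight (n - (card (N v) + 2))"
  proof (rule sum_bound)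
    fix u assume u: "u \<in> outer v"
    show "20 * m (C u \<union> C v) \<le> weight (n - (card (N v) + 2))"
      using u sub outer_bound[OF u] by (intro bound CV) (auto simp: card_C)
  qed
  have "(\<Sum>u\<in>N v. m (C u \<union> C v)) = (\<Sum>u\<in>N v - outer v. m (C u \<union> C v)) + (\<Sum>u\<in>outer v. m (C u \<union> C v))"
    by (rule sum.subset_diff[OF sub fin_N])
  moreover have "card (N v - outer v) = card (N v) - card (outer v)"
    using sub fin_N finite_subset by (intro card_Diff_subset) auto
  ultimately show ?thesis using branch0[of v] a b by simp
qed

lemma del_vertex_bound: "v \<in> V \<Longrightarrow> 20 * m {v} \<le> weight (n - 1)"
  using bound[of "{v}" 1] by simp

text \<open>Here \<open>H\<close> is a union of components of the graph without \<open>S\<close>. As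
  \<open>m\<close> takes the deleted set, \<open>m (V - H)\<close> counts for the subgraph induced
  by \<open>H\<close>.\<close>

lemma m_product:
  assumes H: "H \<subseteq> V" "S \<subseteq> V" "H \<inter> S = {}"
    and closed: "\<And>e. e \<in> del E S \<Longrightarrow> e \<subseteq> H \<or> e \<inter> H = {}"
  shows "m S = m (V - H) * m (S \<union> H)"
proof -
  have "del E S \<subseteq> del E (V - H) \<union> del E (S \<union> H)"
    using closed by (auto simp: del_def)
  moreover have "del E (V - H) \<subseteq> del E S"
  proof
    fix e assume e: "e \<in> del E (V - H)"
    then have "e \<in> E" "e \<subseteq> H" using edge_sub[of e] by (auto simp: del_def)
    then show "e \<in> del E S" using H(3) by (auto simp: del_def)
  qed
  ultimately have eq: "del E S = del E (V - H) \<union> del E (S \<union> H)" by (auto simp: del_def)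
  have "\<Union>(del E (V - H)) \<subseteq> H" using edge_sub by (fastforce simp: del_def)
  then have "\<Union>(del E (V - H)) \<inter> \<Union>(del E (S \<union> H)) = {}"
    unfolding del_def by blast
  moreover have "\<forall>e\<in>del E (V - H) \<union> del E (S \<union> H). card e = 2"
    using card_edge by (auto simp: del_def)
  ultimately show ?thesis unfolding eq by (rule MIM_disjoint_Un[rotated])
qed

definition extremal_bound :: bool where
  "extremal_bound \<longleftrightarrow> 20 * card (MIM E) \<le> weight n \<and>
    (20 * card (MIM E) = weight n \<longrightarrow> (\<exists>K\<in>optimal_sizes. clusters V E K))"

lemma extremal_bound_strict: "20 * card (MIM E) < weight n \<Longrightarrow> extremal_bound"
  by (simp add: extremal_bound_def)

section \<open>The closed neighbourhood as a component\<close>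

lemma closed_C:
  assumes "outer v = {}" "e \<in> E"
  shows "e \<subseteq> C v \<or> e \<inter> C v = {}"
proof (rule disjCI)
  assume "e \<inter> C v \<noteq> {}"
  then obtain x where x: "x \<in> e" "x \<in> C v" by auto
  then obtain y where y: "y \<in> N x" "e = {y, x}" using edge_through[OF assms(2)] by blast
  have "C x \<subseteq> C v" using x(2) assms(1) by (auto simp: cnbrs_def outer_def)
  then have "y \<in> C v" using y(1) by (auto simp: cnbrs_def)
  then show "e \<subseteq> C v" using x y by simp
qed

text \<open>Branch at \<open>v\<close>, which is adjacent to all of the component: an edge at
  \<open>v\<close> leaves nothing and counts once, and the other \<open>d\<close> vertices admit at
  most \<open>d choose 2\<close>. The total is \<open>(d + 1) choose 2\<close> by Pascal's rule, and
  equality forces the neighbours of \<open>v\<close> to span a complete graph.\<close>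

lemma card_MIM_universal:
  assumes v: "v \<in> V" and out: "outer v = {}" and d: "d = card (N v)" "d = 3 \<or> d = 4 \<or> d = 5"
  shows "m (V - C v) \<le> (d + 1) choose 2 \<and>
    (m (V - C v) = (d + 1) choose 2 \<longrightarrow> del E (V - C v) = all_edges (C v))"
proof -
  define S where "S = insert v (V - C v)"
  have "m (V - C v) \<le> m S + (\<Sum>u\<in>N v - (V - C v). m (V - C v \<union> C u \<union> C v))"
    unfolding S_def by (rule branch) (simp add: cnbrs_def)
  also have "N v - (V - C v) = N v" by (auto simp: cnbrs_def)
  also have "(\<Sum>u\<in>N v. m (V - C v \<union> C u \<union> C v)) = (\<Sum>u\<in>N v. 1)"
  proof (rule sum.cong[OF refl])
    fix u assume "u \<in> N v"
    then have "V - C v \<union> C u \<union> C v = V" using C_sub N_sub v by blast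
    moreover have "del E V = {}"
    proof (rule equals0I)
      fix e assume "e \<in> del E V"
      then have "e \<in> E" "e = {}" using edge_sub[of e] by (auto simp: del_def)
      then show False using card_edge by fastforce
    qed
    ultimately show "m (V - C v \<union> C u \<union> C v) = 1" by (simp add: MIM_empty)
  qed
  finally have le: "m (V - C v) \<le> m S + d" using d by simp
  have S: "S \<subseteq> V" "S \<noteq> {}" "V - S = N v"
    using v N_sub[of v] not_in_N[of v] by (auto simp: S_def cnbrs_def)
  have G: "simple_graph (N v) (del E S)" using simple_graph_del[OF graph, of S] S(3) by simp
  have c: "(3::nat) choose 2 = 3" "(4::nat) choose 2 = 6" "(5::nat) choose 2 = 10" "(6::nat) choose 2 = 15"
    by (simp_all add: choose_two)
  have w: "weight 4 = 120" "weight 5 = 200" by (simp_all add: weight_def)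
  have inner: "m S \<le> d choose 2 \<and> (m S = d choose 2 \<longrightarrow> del E S = all_edges (N v))"
  proof (cases "d = 3")
    case True
    then show ?thesis using card_MIM_triangle[OF G] d(1) c by simp
  next
    case False
    then have d': "d = 4 \<or> d = 5" using d(2) by simp
    then have wd: "weight d = 20 * (d choose 2)" using c w by auto
    have "20 * m S \<le> weight d" using IH[OF S(1,2)] S(3) d(1) by simp
    then have "m S \<le> d choose 2" using wd by simp
    moreover have "del E S = all_edges (N v)" if eq: "m S = d choose 2"
    proof -
      obtain K where K: "K \<in> optimal_sizes" "clusters (N v) (del E S) K"
        using IH_eq[OF S(1,2)] S(3) eq wd d(1) by auto
      then have "K = {#d#}" using optimal_sizes_single[OF K(1), of d] clusters_card[OF K(2)] d d' by simp
      then show ?thesis using clusters_single K(2) by blast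
    qed
    ultimately show ?thesis by blast
  qed
  have cs: "(d + 1) choose 2 = (d choose 2) + d" using d(2) c by auto
  show ?thesis
  proof (intro conjI impI)
    show "m (V - C v) \<le> (d + 1) choose 2" using le inner cs by linarith
    assume "m (V - C v) = (d + 1) choose 2"
    then have "m S = d choose 2" using le inner cs by linarith
    then have complete: "del E S = all_edges (N v)" using inner by blast
    show "del E (V - C v) = all_edges (C v)"
    proof
      have "V - (V - C v) = C v" using C_sub[OF v] by auto
      then show "del E (V - C v) \<subseteq> all_edges (C v)"
        using simple_graph_subset_all_edges[OF simple_graph_del[OF graph, of "V - C v"]] by simp
      show "all_edges (C v) \<subseteq> del E (V - C v)"
      proof
        fix e assume "e \<in> all_edges (C v)"
        then have e: "e \<subseteq> C v" "card e = 2" by (auto simp: all_edges_def)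
        have "e \<in> E"
        proof (cases "v \<in> e")
          case True
          then obtain u where u: "e = {u, v}" "u \<noteq> v" using card_2_other[OF e(2)] by blast
          then have "u \<in> N v" using e(1) by (simp add: cnbrs_def)
          then show ?thesis using u by (simp add: nbrs_def)
        next
          case False
          then have "e \<in> all_edges (N v)" using e by (auto simp: all_edges_def cnbrs_def)
          then show ?thesis using complete del_subset by blast
        qed
        then show "e \<in> del E (V - C v)" using e(1) by (auto simp: del_def)
      qed
    qed
  qed
qed

text \<open>The count factors into that of the component and that of the rest. Degrees 1 and 2 lose
  strictly; otherwise equality requires a complete component, an extremal rest and a fitting
  residue.\<close>

lemma component_case:
  assumes v: "v \<in> V" and out: "outer v = {}" and d: "d = card (N v)" "1 \<le> d" "d \<le> 5"
  shows extremal_bound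
proof -
  let ?H = "C v"
  have H: "?H \<subseteq> V" by (rule C_sub[OF v])
  have cH: "card ?H = d + 1" using card_C d by simp
  then have nH: "?H \<noteq> {}" by auto
  have "d + 1 \<le> n" using card_mono[OF fin_V H] cH by simp
  define x where "x = n - (d + 1)"
  have n: "n = x + (d + 1)" using \<open>d + 1 \<le> n\<close> by (simp add: x_def)
  have cVH: "card (V - ?H) = x" using card_Diff_subset[OF fin_C H] cH by (simp add: x_def)
  have prod: "card (MIM E) = m (V - ?H) * m ?H"
    using m_product[OF H, of "{}"] closed_C[OF out] by (simp add: del_empty)
  have mH: "20 * m ?H \<le> weight x" using IH[OF H nH] cVH by simp
  have tot: "20 * card (MIM E) = m (V - ?H) * (20 * m ?H)" using prod by simp
  have VVH: "V - (V - ?H) = ?H" using H by auto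
  have G: "simple_graph ?H (del E (V - ?H))" using simple_graph_del[OF graph, of "V - ?H"] VVH by simp
  consider "d = 1" | "d = 2" | "d = 3 \<or> d = 4 \<or> d = 5" using d by linarith
  then show ?thesis
  proof cases
    case 1
    have "card (all_edges ?H) = 1"
      using n_subsets[OF fin_C[of v], of 2] cH 1 by (simp add: all_edges_def choose_two)
    then have "card (del E (V - ?H)) \<le> 1"
      using card_mono[OF _ simple_graph_subset_all_edges[OF G]] by (metis card.infinite zero_neq_one)
    then have "m (V - ?H) \<le> 1" using card_MIM_le_3[OF G] cH 1 by auto
    then have "20 * card (MIM E) \<le> 1 * weight x" unfolding tot using mH by (rule mult_le_mono)
    moreover have "weight x < weight n" using strict_monoD[OF weight_strict_mono] n by simp
    ultimately show ?thesis by (intro extremal_bound_strict) simp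
  next
    case 2
    have "m (V - ?H) \<le> 3" using card_MIM_triangle[OF G] cH 2 by simp
    then have "20 * card (MIM E) \<le> 3 * weight x" unfolding tot using mH by (rule mult_le_mono)
    moreover have "3 * weight x < weight (x + 3)" by (cases rule: weight_cases[of x]) simp_all
    ultimately show ?thesis using n 2 by (intro extremal_bound_strict) simp
  next
    case 3
    define c where "c = (d + 1) choose 2"
    have c: "d = 3 \<Longrightarrow> c = 6" "d = 4 \<Longrightarrow> c = 10" "d = 5 \<Longrightarrow> c = 15"
      by (simp_all add: c_def choose_two)
    \<comment> \<open>The residues at which a clique of order \<open>d + 1\<close> loses nothing are
      exactly those at which adding it stays within \<open>optimal_sizes\<close>.\<close>
    have cw: "c * weight x \<le> weight n \<and> (c * weight x = weight n \<longrightarrow>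
      d = 3 \<and> (x mod 5 = 0 \<or> x mod 5 = 4) \<or> d = 4 \<or> d = 5 \<and> (x mod 5 = 0 \<or> x mod 5 = 1))"
      unfolding n using 3 by (elim disjE; cases rule: weight_cases[of x]) (simp_all add: c)
    have u: "m (V - ?H) \<le> c" "m (V - ?H) = c \<Longrightarrow> del E (V - ?H) = all_edges ?H"
      using card_MIM_universal[OF v out d(1) 3] by (simp_all add: c_def)
    show ?thesis
    proof (cases "m (V - ?H) = c")
      case False
      \<comment> \<open>Counts are integers, so an incomplete component loses a full
        \<open>weight x\<close>.\<close>
      then have "m (V - ?H) \<le> c - 1" "0 < c" using u(1) by auto
      then have "20 * card (MIM E) \<le> (c - 1) * weight x" unfolding tot using mH by (intro mult_le_mono)
      also have "\<dots> < c * weight x" using \<open>0 < c\<close> weight_pos[of x] by simp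
      finally show ?thesis using cw by (intro extremal_bound_strict) simp
    next
      case True
      have t: "20 * card (MIM E) = c * (20 * m ?H)" using tot True by simp
      have le: "c * (20 * m ?H) \<le> c * weight x" using mH by simp
      have "\<exists>K\<in>optimal_sizes. clusters V E K" if eq: "20 * card (MIM E) = weight n"
      proof -
        have cx: "c * weight x = weight n" using t le cw eq by linarith
        have "c > 0" using c 3 by auto
        then have "20 * m ?H = weight x" using cx t eq by simp
        then obtain K where K: "K \<in> optimal_sizes" "clusters (V - ?H) (del E ?H) K"
          using IH_eq[OF H nH] cVH by auto
        have sK: "sum_mset K = x" using clusters_card[OF K(2)] cVH by simp
        have "clusters (?H \<union> (V - ?H)) (all_edges ?H \<union> del E ?H) (add_mset (card ?H) K)"
          using K(2) fin_C cH d by (intro clusters.add) auto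
        moreover have "?H \<union> (V - ?H) = V" using H by auto
        moreover have "all_edges ?H \<union> del E ?H = E"
        proof -
          have "del E (V - ?H) \<union> del E ?H = E"
            using closed_C[OF out] edge_sub by (auto simp: del_def)
          then show ?thesis using u(2)[OF True] by simp
        qed
        ultimately have "clusters V E (add_mset (d + 1) K)" using cH by simp
        moreover have "add_mset (d + 1) K \<in> optimal_sizes"
        proof -
          consider "d = 3" "sum_mset K mod 5 = 0 \<or> sum_mset K mod 5 = 4" | "d = 4"
            | "d = 5" "sum_mset K mod 5 = 0 \<or> sum_mset K mod 5 = 1" using cw cx sK by auto
          then show ?thesis
          proof cases
            case 1
            then show ?thesis using optimal_sizes_add_4[OF K(1)] by simp
          next
            case 2
            then show ?thesis using optimal_sizes_add_5[OF K(1)] by simp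
          next
            case 3
            then show ?thesis using optimal_sizes_add_6[OF K(1)] by simp
          qed
        qed
        ultimately show ?thesis by blast
      qed
      moreover have "20 * card (MIM E) \<le> weight n" using t le cw by linarith
      ultimately show ?thesis by (simp add: extremal_bound_def)
    qed
  qed
qed

text \<open>Branching at the cut vertex \<open>u\<close> beats branching at \<open>v\<close>: the rest of the closed neighbourhood of
  \<open>v\<close> becomes a union of components of \<open>d\<close> vertices when \<open>u\<close> is deleted.\<close>

lemma cut_vertex_case:
  assumes v: "v \<in> V" and out: "outer v = {u}" and d: "d = card (N v)" "d = 3 \<or> d = 4"
    and max: "card (N u) \<le> d"
  shows "20 * card (MIM E) < weight n"
proof -
  have u: "u \<in> N v" "\<not> C u \<subseteq> C v" using out by (auto simp: outer_def)
  then obtain u' where u': "u' \<in> C u" "u' \<notin> C v" by blast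
  have uV: "u \<in> V" using u(1) N_sub by blast
  have uC: "u \<in> C v" "v \<noteq> u" using u(1) not_in_N by (auto simp: cnbrs_def)
  have vu: "v \<in> N u" using u(1) nbrs_sym by metis
  have u'u: "u' \<in> N u" "u' \<noteq> v" using u' uC by (auto simp: cnbrs_def)
  let ?H = "C v - {u}"
  have H: "?H \<subseteq> V" using C_sub[OF v] by blast
  have cH: "card ?H = d" using card_C[of v] uC fin_C d by simp
  have closed: "e \<subseteq> ?H \<or> e \<inter> ?H = {}" if e: "e \<in> del E {u}" for e
  proof (rule disjCI)
    assume "e \<inter> ?H \<noteq> {}"
    then obtain x where x: "x \<in> e" "x \<in> ?H" by auto
    have eE: "e \<in> E" "u \<notin> e" using e by (auto simp: del_def)
    then obtain y where y: "y \<in> N x" "e = {y, x}" using edge_through x(1) by blast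
    have "x = v \<or> x \<in> N v - outer v" using x(2) out by (auto simp: cnbrs_def)
    then have "C x \<subseteq> C v" by (auto simp: outer_def)
    then have "y \<in> C v" using y(1) by (auto simp: cnbrs_def)
    then show "e \<subseteq> ?H" using x y eE by auto
  qed
  have "{u} \<union> ?H = C v" using uC by auto
  then have prod: "m {u} = m (V - ?H) * m (C v)"
    using m_product[OF H _ _ closed] uV by simp
  have ne: "V - ?H \<subseteq> V" "V - ?H \<noteq> {}" "V - (V - ?H) = ?H" using uV H by auto
  have h: "20 * m (V - ?H) \<le> weight d" using IH[OF ne(1,2)] ne(3) cH by simp
  have "20 * m (C v) \<le> weight (n - (d + 1))" using C_sub[OF v] card_C d by (intro bound) auto
  then have mu: "20 * m {u} \<le> m (V - ?H) * weight (n - (d + 1))" unfolding prod by simp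
  define e where "e = card (N u)"
  have "card {v, u'} \<le> e" unfolding e_def using vu u'u fin_N by (intro card_mono) auto
  then have e: "2 \<le> e" "e \<le> d" using u'u max by (auto simp: e_def)
  have CuV: "C z \<union> C u \<subseteq> V" if "z \<in> N u" for z using that N_sub C_sub uV by blast
  have "card (insert u' (C v)) \<le> card (C v \<union> C u)" using u' fin_C by (intro card_mono) auto
  then have "d + 2 \<le> card (C v \<union> C u)" using u' fin_C card_C[of v] d by simp
  then have b1: "20 * m (C v \<union> C u) \<le> weight (n - (d + 2))" using CuV[OF vu] by (intro bound) auto
  have b2: "20 * (\<Sum>z\<in>N u - {v}. m (C z \<union> C u)) \<le> card (N u - {v}) * weight (n - (e + 1))"
  proof (rule sum_bound)
    fix z assume z: "z \<in> N u - {v}"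
    have "card (C u) \<le> card (C z \<union> C u)" using fin_C by (intro card_mono) auto
    then show "20 * m (C z \<union> C u) \<le> weight (n - (e + 1))"
      using z CuV[of z] card_C[of u] by (intro bound) (auto simp: e_def)
  qed
  have "card (N u - {v}) = e - 1" using vu fin_N by (simp add: e_def)
  moreover have "(\<Sum>z\<in>N u. m (C z \<union> C u)) = m (C v \<union> C u) + (\<Sum>z\<in>N u - {v}. m (C z \<union> C u))"
    by (rule sum.remove[OF fin_N vu])
  \<comment> \<open>The three terms belong to \<open>u\<close> uncovered, to the edge from
    \<open>u\<close> to \<open>v\<close>, and to the other \<open>e - 1\<close> edges at
    \<open>u\<close>.\<close>
  ultimately have main: "20 * card (MIM E) \<le>
    m (V - ?H) * weight (n - (d + 1)) + weight (n - (d + 2)) + (e - 1) * weight (n - (e + 1))"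
    using branch0[of u] b1 b2 mu by simp
  have "n \<ge> d + 2" using outer_order[of u v] out d by simp
  then have "n = (n - (d + 2)) + (d + 2)" by simp
  then obtain x where n: "n = x + (d + 2)" by blast
  show ?thesis
  proof (cases "d = 3")
    case True
    \<comment> \<open>The induction hypothesis gives 72/20 = 3.6, which integrality lowers to 3;
      with 3.6 the final estimate would fail for \<open>x mod 5 = 3\<close> and
      \<open>e = 3\<close>.\<close>
    have "weight 3 = 72" by (simp add: weight_def)
    then have "m (V - ?H) \<le> 3" using h True by simp
    then have "m (V - ?H) * weight (x + 1) \<le> 3 * weight (x + 1)" by simp
    moreover have "e = 2 \<or> e = 3" using e True by linarith
    moreover have "3 * weight (x + 1) + weight x + weight (x + 2) < weight (x + 5)"
      "3 * weight (x + 1) + weight x + 2 * weight (x + 1) < weight (x + 5)"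
      by (cases rule: weight_cases[of x]; simp)+
    ultimately show ?thesis using main True n by (elim disjE) (simp_all add: numeral_eq_Suc)
  next
    case False
    then have d4: "d = 4" using d by simp
    have "weight 4 = 120" by (simp add: weight_def)
    then have "m (V - ?H) \<le> 6" using h d4 by simp
    then have "m (V - ?H) * weight (x + 1) \<le> 6 * weight (x + 1)" by simp
    moreover have "e = 2 \<or> e = 3 \<or> e = 4" using e d4 by linarith
    moreover have "6 * weight (x + 1) + weight x + weight (x + 3) < weight (x + 6)"
      "6 * weight (x + 1) + weight x + 2 * weight (x + 2) < weight (x + 6)"
      "6 * weight (x + 1) + weight x + 3 * weight (x + 1) < weight (x + 6)"
      by (cases rule: weight_cases[of x]; simp)+
    ultimately show ?thesis using main d4 n by (elim disjE) (simp_all add: numeral_eq_Suc)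
  qed
qed

text \<open>The inner neighbour \<open>a\<close> cannot be adjacent to \<open>u\<close>, which would
  then have the three neighbours \<open>v\<close>, \<open>a\<close> and \<open>u'\<close>. So
  \<open>a\<close> is isolated once \<open>v\<close> is gone, and \<open>m {v}\<close> is bounded by
  \<open>weight (n - 2)\<close>.\<close>

lemma degree_2_pendant_case:
  assumes v: "v \<in> V" and out: "outer v = {u}" and d: "card (N v) = 2" and max: "card (N u) \<le> 2"
  shows "20 * card (MIM E) < weight n"
proof -
  have u: "u \<in> N v" "\<not> C u \<subseteq> C v" using out by (auto simp: outer_def)
  have "card (N v - {u}) = 1" using u(1) d fin_N by simp
  then obtain a where "N v - {u} = {a}" by (auto simp: card_1_singleton_iff)
  then have Nv: "N v = {a, u}" "a \<noteq> u" using u(1) by auto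
  then have Ca: "C a \<subseteq> C v" using out by (auto simp: outer_def)
  obtain u' where u': "u' \<in> C u" "u' \<notin> C v" using u(2) by blast
  have av: "a \<noteq> v" "u \<noteq> v" using not_in_N[of v] Nv by auto
  have u'ne: "u' \<noteq> v" "u' \<noteq> a" using u'(2) Nv(1) by (simp_all add: cnbrs_def)
  have "u \<notin> N a"
  proof
    assume "u \<in> N a"
    then have "{v, a, u'} \<subseteq> N u" using u u' Nv nbrs_sym[of u E a] nbrs_sym[of u E v] by (auto simp: cnbrs_def)
    then have "card {v, a, u'} \<le> card (N u)" by (rule card_mono[OF fin_N])
    moreover have "card {v, a, u'} = 3" using av u'ne by simp
    ultimately show False using max by simp
  qed
  then have na: "N a - {v} = {}" using Ca Nv not_in_N[of a] by (auto simp: cnbrs_def)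
  have "m {v} \<le> m {a, v}" using branch[of a "{v}", unfolded na] av by simp
  moreover have "20 * m {a, v} \<le> weight (n - 2)"
    using v Nv N_sub[of v] av by (intro bound) auto
  moreover have "20 * card (MIM E) \<le> 20 * m {v} + weight (n - 3) + weight (n - 4)"
    using direct[OF v] out d by simp
  ultimately have "20 * card (MIM E) \<le> weight (n - 2) + weight (n - 3) + weight (n - 4)" by linarith
  moreover have "n \<ge> 4" using outer_order[of u v] out d by simp
  then have "n = (n - 4) + 4" by simp
  then obtain x where n: "n = x + 4" by blast
  then have "n - 2 = x + 2" "n - 3 = x + 1" "n - 4 = x" by simp_all
  moreover have "weight (x + 2) + weight (x + 1) + weight x < weight (x + 4)"
    by (cases rule: weight_cases[of x]) simp_all
  ultimately show ?thesis by (simp only: n)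
qed

text \<open>The plain branching inequality is slightly too weak for orders 1 and 2 modulo 5, so the graph
  without \<open>v\<close> is branched again, at the inner neighbour \<open>a\<close> of \<open>v\<close>, and if \<open>a\<close> is a twin of \<open>v\<close> once
  more at an outer neighbour.\<close>

lemma degree_3_case:
  assumes v: "v \<in> V" and out: "card (outer v) = 2" and d: "card (N v) = 3"
    and max: "\<And>u. u \<in> V \<Longrightarrow> card (N u) \<le> 3"
  shows "20 * card (MIM E) < weight n"
proof -
  have sub: "outer v \<subseteq> N v" by (auto simp: outer_def)
  have "card (N v - outer v) = 1"
    using card_Diff_subset[OF finite_subset[OF sub fin_N] sub] d out by simp
  then obtain a where a: "N v - outer v = {a}" by (auto simp: card_1_singleton_iff)
  then have aN: "a \<in> N v" "a \<notin> outer v" "N v = insert a (outer v)" using sub by blast+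
  have Ca: "C a \<subseteq> C v" using aN(1,2) by (auto simp: outer_def)
  have av: "a \<noteq> v" "v \<in> N a" "v \<notin> outer v" "a \<in> V"
    using not_in_N[of v] aN(1) nbrs_sym[of a E v] N_sub[of v] sub by auto
  have Na: "N a - {v} \<subseteq> outer v" using Ca aN not_in_N[of a] by (auto simp: cnbrs_def)
  have "n \<ge> 5"
  proof -
    obtain z where "z \<in> outer v" using out by fastforce
    then show ?thesis using outer_order[of z v] d by simp
  qed
  then have "n = (n - 5) + 5" by simp
  then obtain x where n: "n = x + 5" by blast
  then have nx: "n - 1 = x + 4" "n - 2 = x + 3" "n - 3 = x + 2" "n - 4 = x + 1" "n - 5 = x"
    by simp_all
  have dir: "20 * card (MIM E) \<le> 20 * m {v} + weight (x + 1) + 2 * weight x"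
    using direct[OF v] out d nx by simp
  have dir': "20 * m {v} \<le> weight (x + 4)" using del_vertex_bound[OF v] unfolding nx .
  have av2: "20 * m {a, v} \<le> weight (x + 3)"
    unfolding nx(2)[symmetric] using v av by (intro bound) auto
  have br: "m {v} \<le> m {a, v} + (\<Sum>z\<in>N a - {v}. m ({v} \<union> C z \<union> C a))"
    using branch[of a "{v}"] av by simp
  have fin_out: "finite (outer v)" using finite_subset[OF sub fin_N] .
  have "card (N a - {v}) \<le> 2" using card_mono[OF fin_out Na] out by simp
  then consider "card (N a - {v}) = 0" | "card (N a - {v}) = 1" | "card (N a - {v}) = 2" by linarith
  then show ?thesis
  proof cases
    case 1
    then have na: "N a - {v} = {}" using fin_N[of a] by (metis card_eq_0_iff finite_Diff)
    have "20 * m {v} \<le> weight (x + 3)" using br av2 unfolding na by simp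
    moreover have "weight (x + 3) + weight (x + 1) + 2 * weight x < weight (x + 5)"
      by (cases rule: weight_cases[of x]) simp_all
    ultimately show ?thesis using dir unfolding n by linarith
  next
    case 2
    then obtain z where z: "N a - {v} = {z}" by (auto simp: card_1_singleton_iff)
    then have zo: "z \<in> outer v" using Na by auto
    then obtain z' where z': "z' \<in> C z" "z' \<notin> C v" unfolding outer_def by blast
    have zN: "z \<in> N v" using zo sub by blast
    have zV: "z \<in> V" "z \<noteq> a" "z \<noteq> v" using zN zo N_sub[of v] aN(2) av(3) by blast+
    have z'ne: "z' \<noteq> v" "z' \<noteq> a" "z' \<noteq> z" using z'(2) zN aN(1) by (auto simp: cnbrs_def)
    have "{v, a, z, z'} \<subseteq> {v} \<union> C z \<union> C a" using z' by (auto simp: cnbrs_def)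
    then have "card {v, a, z, z'} \<le> card ({v} \<union> C z \<union> C a)" using fin_C by (intro card_mono) auto
    moreover have "card {v, a, z, z'} = 4" using zV z'ne av by auto
    moreover have "{v} \<union> C z \<union> C a \<subseteq> V" using v C_sub zV av by simp
    ultimately have "20 * m ({v} \<union> C z \<union> C a) \<le> weight (n - 4)" by (intro bound) auto
    then have "20 * m {v} \<le> weight (x + 3) + weight (x + 1)" using br av2 nx unfolding z by simp
    moreover have "weight (x + 3) + weight (x + 1) + weight (x + 1) + 2 * weight x < weight (x + 5)"
      by (cases rule: weight_cases[of x]) simp_all
    ultimately show ?thesis using dir unfolding n by linarith
  next
    case 3
    then have Na_eq: "N a - {v} = outer v" using Na out card_subset_eq[OF fin_out Na] by simp
    \<comment> \<open>Twins have the same closed neighbourhood, so an edge at \<open>a\<close>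
      removes as much as the corresponding edge at \<open>v\<close>, namely at least five
      vertices.\<close>
    have Cz: "{v} \<union> C z \<union> C a = C z \<union> C v" for z
    proof -
      have "N a = insert v (outer v)" using Na_eq av(2) by blast
      then have "C a = C v" using aN(3) by (auto simp: cnbrs_def)
      then show ?thesis by (auto simp: cnbrs_def)
    qed
    have "20 * (\<Sum>z\<in>N a - {v}. m ({v} \<union> C z \<union> C a)) \<le> card (N a - {v}) * weight x"
    proof (rule sum_bound)
      fix z assume "z \<in> N a - {v}"
      then have zo: "z \<in> outer v" using Na_eq by simp
      then have "C z \<union> C v \<subseteq> V" using sub N_sub C_sub v by blast
      then have "20 * m (C z \<union> C v) \<le> weight (n - 5)"
        using outer_bound[OF zo] card_C[of v] d by (intro bound) auto
      then show "20 * m ({v} \<union> C z \<union> C a) \<le> weight x" unfolding Cz nx .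
    qed
    then have s: "20 * m {v} \<le> 20 * m {a, v} + 2 * weight x" using br 3 by simp
    obtain u where uo: "u \<in> outer v" using out by fastforce
    then obtain u' where u': "u' \<in> C u" "u' \<notin> C v" unfolding outer_def by blast
    have uN: "u \<in> N v" "u \<in> N a" using uo sub Na_eq by blast+
    have uV: "u \<in> V" "u \<noteq> a" "u \<noteq> v" using uN uo N_sub[of v] aN(2) av(3) by blast+
    have u'ne: "u' \<noteq> v" "u' \<noteq> a" "u' \<noteq> u" using u'(2) uN aN(1) by (auto simp: cnbrs_def)
    have "u' \<in> N u" using u'(1) u'ne by (simp add: cnbrs_def)
    then have au: "{v, a, u'} \<subseteq> N u"
      using uN nbrs_sym[of u E v] nbrs_sym[of u E a] by simp
    moreover have c3: "card {v, a, u'} = 3" using u'ne av by auto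
    ultimately have "N u = {v, a, u'}"
      using card_seteq[OF fin_N au] max[OF uV(1)] by presburger
    \<comment> \<open>The degree bound leaves \<open>u\<close> a single neighbour once
      \<open>a\<close> and \<open>v\<close> are deleted, so this last branching has only two
      terms.\<close>
    then have Nu: "N u - {a, v} = {u'}" using u'ne by auto
    have "m {a, v} \<le> m {u, a, v} + m ({a, v} \<union> C u' \<union> C u)"
      using branch[of u "{a, v}"] uV Nu by simp
    moreover have "20 * m {u, a, v} \<le> weight (n - 3)" using uV av v by (intro bound) auto
    moreover have "20 * m ({a, v} \<union> C u' \<union> C u) \<le> weight (n - 4)"
    proof (rule bound)
      have "u' \<in> V" using au N_sub[of u] by auto
      then show "{a, v} \<union> C u' \<union> C u \<subseteq> V" using v av uV C_sub by simp
      have "{v, a, u, u'} \<subseteq> {a, v} \<union> C u' \<union> C u" by (auto simp: cnbrs_def)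
      then have "card {v, a, u, u'} \<le> card ({a, v} \<union> C u' \<union> C u)" using fin_C by (intro card_mono) auto
      moreover have "card {v, a, u, u'} = 4" using uV u'ne av by auto
      ultimately show "4 \<le> card ({a, v} \<union> C u' \<union> C u)" by simp
    qed simp
    ultimately have "20 * m {v} \<le> weight (x + 2) + weight (x + 1) + 2 * weight x"
      using s unfolding nx by linarith
    \<comment> \<open>The refined estimate fails for \<open>x mod 5 = 3\<close> (728 against 720),
      where the plain one suffices (714).\<close>
    moreover have "weight (x + 2) + weight (x + 1) + 2 * weight x + weight (x + 1) + 2 * weight x < weight (x + 5)
      \<or> weight (x + 4) + weight (x + 1) + 2 * weight x < weight (x + 5)"
      by (cases rule: weight_cases[of x]) simp_all
    ultimately show ?thesis using dir dir' unfolding n by linarith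
  qed
qed

text \<open>For orders 1 and 2 modulo 5 the branching inequality is tight only if the graph without \<open>v\<close> is
  extremal; then every neighbour of \<open>v\<close> has degree at least 5.\<close>

lemma degree_4_case:
  assumes v: "v \<in> V" and out: "card (outer v) = 2" and d: "card (N v) = 4"
    and max: "\<And>u. u \<in> V \<Longrightarrow> card (N u) \<le> 4"
  shows "20 * card (MIM E) < weight n"
proof -
  obtain u where uo: "u \<in> outer v" using out by fastforce
  then have u: "u \<in> N v" "u \<in> V" "u \<noteq> v" "v \<in> N u" "n \<ge> 6"
    using N_sub[of v] not_in_N[of v] nbrs_sym[of u E v] outer_order[OF uo] d by (auto simp: outer_def)
  then have "n = (n - 6) + 6" by simp
  then obtain x where n: "n = x + 6" by blast
  then have nx: "n - 1 = x + 5" "n - 5 = x + 1" "n - 6 = x" by simp_all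
  have dir: "20 * card (MIM E) \<le> 20 * m {v} + 2 * weight (x + 1) + 2 * weight x"
    using direct[OF v] out d nx by simp
  have le: "20 * m {v} \<le> weight (x + 5)" using del_vertex_bound[OF v] unfolding nx .
  have cV: "card (V - {v}) = x + 5" using v n by simp
  \<comment> \<open>Ties occur at \<open>x mod 5 = 0\<close> and \<open>x mod 5 = 1\<close>. There
    an extremal graph of order \<open>x + 5\<close> consists of cliques of order 5 and 6
    only.\<close>
  have w: "weight (x + 5) + 2 * weight (x + 1) + 2 * weight x < weight (x + 6) \<or>
    weight (x + 5) + 2 * weight (x + 1) + 2 * weight x = weight (x + 6) \<and> ((x + 5) mod 5 = 0 \<or> (x + 5) mod 5 = 1)"
    by (cases rule: weight_cases[of x]) simp_all
  have "20 * m {v} \<noteq> weight (x + 5)" if r: "(x + 5) mod 5 = 0 \<or> (x + 5) mod 5 = 1"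
  proof
    assume "20 * m {v} = weight (x + 5)"
    then obtain K where K: "K \<in> optimal_sizes" "clusters (V - {v}) (del E {v}) K"
      using IH_eq[of "{v}"] v cV by auto
    have "sum_mset K mod 5 = 0 \<or> sum_mset K mod 5 = 1" using clusters_card[OF K(2)] cV r by simp
    then have "\<forall>k\<in>#K. Suc 4 \<le> k" using optimal_sizes_ge_5[OF K(1)] by simp
    then have "4 \<le> card (nbrs (del E {v}) u)" using clusters_degree[OF K(2)] u by blast
    also have "nbrs (del E {v}) u = N u - {v}" using u(3) by (auto simp: nbrs_def del_def)
    also have "card (N u - {v}) < card (N u)" using u(4) fin_N by (intro psubset_card_mono) auto
    finally show False using max[OF u(2)] by simp
  qed
  then show ?thesis using dir le w unfolding n by linarith
qed

text \<open>With \<open>s\<close> outer neighbours of a vertex of maximum degree \<open>d\<close>,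
  the plain estimate settles \<open>d \<ge> 6\<close> and the pairs (2, 2), (3, 3), (4, 3), (4, 4)
  and (5, s) with \<open>s > 0\<close>; all other pairs have been prepared above, except (1, 1),
  which contradicts maximality.\<close>

lemma main_step: extremal_bound
proof (cases "E = {}")
  case True
  show ?thesis
  proof (cases "V = {}")
    case True
    then have "clusters V E {#}" using \<open>E = {}\<close> clusters.empty by simp
    moreover have "{#} \<in> optimal_sizes" unfolding optimal_sizes_def by (simp add: exI[of _ 0])
    moreover have "20 * card (MIM E) = weight n"
      using True \<open>E = {}\<close> by (simp add: weight_def MIM_empty)
    ultimately show ?thesis unfolding extremal_bound_def by auto
  next
    case False
    \<comment> \<open>An edgeless graph has only the empty matching, and 20 is the weight of order 0
      alone.\<close>
    then have "0 < n" using fin_V by (simp add: card_gt_0_iff)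
    then have "weight 0 < weight n" by (rule strict_monoD[OF weight_strict_mono])
    then show ?thesis using \<open>E = {}\<close> by (intro extremal_bound_strict) (simp add: MIM_empty weight_def)
  qed
next
  case False
  then obtain e where e: "e \<in> E" by blast
  then obtain x where x: "x \<in> e" using card_edge by fastforce
  then obtain y where y: "y \<in> N x" using edge_through[OF e] by blast
  have xV: "x \<in> V" using edge_sub[OF e] x by blast
  then obtain v where v: "v \<in> V" and v_max: "\<And>u. u \<in> V \<Longrightarrow> card (N u) \<le> card (N v)"
    using ex_has_greatest_nat[of "\<lambda>u. u \<in> V" x "\<lambda>u. card (N u)" "Suc n"] card_mono[OF fin_V N_sub]
    by (metis le_imp_less_Suc)
  define d s where "d = card (N v)" and "s = card (outer v)"
  have "card (N x) > 0" using y fin_N by (auto simp: card_gt_0_iff)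
  then have d1: "1 \<le> d" using v_max[OF xV] by (simp add: d_def)
  have sub: "outer v \<subseteq> N v" by (auto simp: outer_def)
  have sd: "s \<le> d" unfolding s_def d_def by (rule card_mono[OF fin_N sub])
  have fin_out: "finite (outer v)" using finite_subset[OF sub fin_N] .
  have dir: "20 * card (MIM E) \<le> weight (n - 1) + (d - s) * weight (n - (d + 1)) + s * weight (n - (d + 2))"
    using direct[OF v] del_vertex_bound[OF v] by (simp add: d_def s_def)
  have s_pos: "d + 2 \<le> n" if "s \<noteq> 0"
  proof -
    have "outer v \<noteq> {}" using that unfolding s_def by auto
    then obtain u where "u \<in> outer v" by blast
    then show ?thesis using outer_order by (simp add: d_def)
  qed
  consider "d \<ge> 6" | "d \<le> 5" "s = 0" | "d \<le> 5" "s \<noteq> 0" by linarith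
  then show ?thesis
  proof cases
    case 1
    have "card (C v) \<le> n" using card_mono[OF fin_V C_sub[OF v]] .
    then have dn: "d + 1 \<le> n" using card_C[of v] by (simp add: d_def)
    have "s * weight (n - (d + 2)) \<le> s * weight (n - (d + 1))"
      by (intro mult_le_mono2 strict_mono_less_eq[OF weight_strict_mono, THEN iffD2] diff_le_mono2) simp
    moreover have "(d - s) * weight (n - (d + 1)) + s * weight (n - (d + 1)) = d * weight (n - (d + 1))"
      using sd by (metis add_mult_distrib le_add_diff_inverse2)
    ultimately show ?thesis
      using dir weight_large_degree[OF 1 dn] by (intro extremal_bound_strict) linarith
  next
    case 2
    then have "outer v = {}" using fin_out by (simp add: s_def)
    then show ?thesis using component_case[OF v _ d_def d1] 2 by simp
  next
    case 3
    then have "n = (n - (d + 2)) + (d + 2)" using s_pos by simp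
    then obtain x where n: "n = x + (d + 2)" by blast
    then have nx: "n - 1 = x + (d + 1)" "n - (d + 1) = x + 1" "n - (d + 2) = x" by simp_all
    have D: "20 * card (MIM E) \<le> weight (x + (d + 1)) + (d - s) * weight (x + 1) + s * weight x"
      using dir unfolding nx .
    have max: "card (N u) \<le> d" if "u \<in> V" for u using v_max[OF that] by (simp add: d_def)
    have single: "\<exists>u. outer v = {u} \<and> u \<in> V" if "s = 1"
      using that sub N_sub[of v] by (auto simp: s_def card_1_singleton_iff)
    have "d = 1 \<or> d = 2 \<or> d = 3 \<or> d = 4 \<or> d = 5" using 3 d1 by linarith
    moreover have "s = 1 \<or> s = 2 \<or> s = 3 \<or> s = 4 \<or> s = 5" using 3 sd by linarith
    ultimately consider "d = 1" "s = 1" | "d = 2" "s = 1" | "d = 2" "s = 2" | "d = 3 \<or> d = 4" "s = 1"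
      | "d = 3" "s = 2" | "d = 3" "s = 3" | "d = 4" "s = 2" | "d = 4" "s = 3 \<or> s = 4"
      | "d = 5" "s = 1 \<or> s = 2 \<or> s = 3 \<or> s = 4 \<or> s = 5"
      using sd by auto
    then have "20 * card (MIM E) < weight n"
    proof cases
      case 1
      obtain u where u: "outer v = {u}" "u \<in> V" using single[OF 1(2)] by blast
      obtain u' where u': "u' \<in> C u" "u' \<notin> C v" "u \<in> N v" using u(1) by (auto simp: outer_def)
      \<comment> \<open>An outer neighbour of a vertex of degree 1 has degree at least 2.\<close>
      have "{v, u'} \<subseteq> N u" using u' nbrs_sym[of u E v] by (auto simp: cnbrs_def)
      then have "card {v, u'} \<le> card (N u)" by (rule card_mono[OF fin_N])
      moreover have "card {v, u'} = 2" using u' by (auto simp: cnbrs_def)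
      ultimately show ?thesis using max[OF u(2)] 1 by simp
    next
      case 2
      then show ?thesis using single[OF 2(2)] degree_2_pendant_case[OF v] max by (auto simp: d_def)
    next
      case 3
      moreover have "weight (x + 3) + 2 * weight x < weight (x + 4)"
        by (cases rule: weight_cases[of x]) simp_all
      ultimately show ?thesis using D n by simp
    next
      case 4
      then show ?thesis using single[OF 4(2)] cut_vertex_case[OF v _ d_def] max by blast
    next
      case 5
      then show ?thesis using degree_3_case[OF v] max by (simp add: d_def s_def)
    next
      case 6
      moreover have "weight (x + 4) + 3 * weight x < weight (x + 5)"
        by (cases rule: weight_cases[of x]) simp_all
      ultimately show ?thesis using D n by simp
    next
      case 7
      then show ?thesis using degree_4_case[OF v] max by (simp add: d_def s_def)
    next
      case 8
      moreover have "weight (x + 5) + weight (x + 1) + 3 * weight x < weight (x + 6)"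
        "weight (x + 5) + 4 * weight x < weight (x + 6)"
        by (cases rule: weight_cases[of x]; simp)+
      ultimately show ?thesis using D n by auto
    next
      case 9
      moreover have "weight (x + 6) + 4 * weight (x + 1) + weight x < weight (x + 7)"
        by (cases rule: weight_cases[of x]) simp_all
      \<comment> \<open>Every further outer neighbour replaces a \<open>weight (x + 1)\<close> by a
        \<open>weight x\<close>, so \<open>s = 1\<close> is the worst case.\<close>
      moreover have "weight x < weight (x + 1)" using strict_monoD[OF weight_strict_mono] by simp
      ultimately show ?thesis using D n by auto
    qed
    then show ?thesis by (rule extremal_bound_strict)
  qed
qed

end

section \<open>The bound for every order, and the theorem\<close>

lemma card_MIM_le_weight:
  "simple_graph V E \<Longrightarrow> 20 * card (MIM E) \<le> weight (card V) \<and>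
    (20 * card (MIM E) = weight (card V) \<longrightarrow> (\<exists>K\<in>optimal_sizes. clusters V E K))"
proof (induction "card V" arbitrary: V E rule: less_induct)
  case less
  have fin: "finite V" by (rule simple_graphD(1)[OF less.prems])
  have IH: "20 * card (MIM (del E S)) \<le> weight (card (V - S)) \<and>
      (20 * card (MIM (del E S)) = weight (card (V - S)) \<longrightarrow>
        (\<exists>K\<in>optimal_sizes. clusters (V - S) (del E S) K))" if S: "S \<subseteq> V" "S \<noteq> {}" for S
  proof (rule less.hyps[OF _ simple_graph_del[OF less.prems]])
    show "card (V - S) < card V" using S fin by (intro psubset_card_mono) auto
  qed
  interpret minimal_graph V E
    using less.prems IH by unfold_locales blast+
  show ?case using main_step by (simp add: extremal_bound_def)
qed

theorem theorem3p2:
  fixes V :: "'a set" and E :: "'a set set" and n :: nat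
  assumes "simple_graph V E" and "card V = n" and "n \<ge> 8"
  shows "card (MIM E) \<le> q n \<and>
    (card (MIM E) = q n \<longleftrightarrow>
       graph_iso V E (cliques_V (extremal_list n)) (cliques_E (extremal_list n)))"
proof -
  have w: "weight (card V) = 20 * q n" using weight_eq_q assms by simp
  have le: "card (MIM E) \<le> q n" using card_MIM_le_weight[OF assms(1)] w by simp
  have "graph_iso V E (cliques_V (extremal_list n)) (cliques_E (extremal_list n))" if "card (MIM E) = q n"
  proof -
    obtain K where K: "K \<in> optimal_sizes" "clusters V E K"
      using card_MIM_le_weight[OF assms(1)] w \<open>card (MIM E) = q n\<close> by auto
    then have "K = mset (extremal_list n)"
      using optimal_sizes_extremal_list[OF K(1)] clusters_card[OF K(2)] assms by simp
    then show ?thesis using clusters_graph_iso K(2) by blast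
  qed
  \<comment> \<open>Conversely, the count depends only on the clique sizes, which an isomorphism
    preserves, and their product of binomials is \<open>q n\<close>.\<close>
  moreover have "card (MIM E) = q n"
    if iso: "graph_iso V E (cliques_V (extremal_list n)) (cliques_E (extremal_list n))"
  proof -
    have "clusters (cliques_V (extremal_list n)) (cliques_E (extremal_list n)) (mset (extremal_list n))"
      by (rule clusters_cliques) (simp add: extremal_list_ge_2)
    then have "clusters V E (mset (extremal_list n))"
      using iso assms(1) by (rule clusters_graph_iso_inv)
    then show ?thesis using clusters_card_MIM prod_extremal_list by metis
  qed
  ultimately show ?thesis using le by blast
qed

end
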